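(* Let $L>0$ and let $\alpha,\beta,\gamma,\delta\ge 0$ with $\gamma\beta+\alpha\gamma+\alpha\delta>0$. Let $a,b\colon[0,L]\to[0,+\infty)$ be continuous functions such that there exist $0<\tau<\sigma<L$ with $$a(x)>0 \text{ on } \,]0,\tau[\,\cup\,]\sigma,L[,\qquad a\equiv 0 \text{ on } [\tau,\sigma],$$ $$b(x)>0 \text{ on } \,]\tau,\sigma[,\qquad b\equiv 0 \text{ on } [0,\tau]\cup[\sigma,L].$$ Let $g,k\colon[0,+\infty)\to[0,+\infty)$ be continuous with $g(0)=k(0)=0$ and $g(s)>0$, $k(s)>0$ for all $s>0$. Assume $$\limsup_{s\to0^{+}}\frac{g(s)}{s}=0,\qquad \liminf_{s\to+\infty}\frac{g(s)}{s}=+\infty,\qquad \limsup_{s\to0^{+}}\frac{k(s)}{s}<+\infty.$$ Then there exists $\mu^{*}>0$ such that for every $\mu>\mu^{*}$ the boundary value problem $$u''+a(x)g(u)-\mu\, b(x)k(u)=0,\qquad \alpha u(0)-\beta u'(0)=0,\qquad \gamma u(L)+\delta u'(L)=0$$ has at least $3$ positive solutions.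
   Context: A solution is a function $u\colon[0,L]\to[0,+\infty)$ such that $u$ and $u'$ are absolutely continuous, the differential equation holds for a.e. $x\in[0,L]$, and the boundary conditions hold. A solution is called positive if $u(x)>0$ for every $x\in\,]0,L[$. *)

theory Defs
  imports "HOL-Analysis.Analysis"
begin

definition abs_continuous_on :: "real \<Rightarrow> real \<Rightarrow> (real \<Rightarrow> real) \<Rightarrow> bool" where
  "abs_continuous_on lo hi f \<longleftrightarrow>
     (\<forall>\<epsilon>>0. \<exists>\<delta>>0. \<forall>(n::nat) (s::nat \<Rightarrow> real) (t::nat \<Rightarrow> real).
        (\<forall>i<n. lo \<le> s i \<and> s i \<le> t i \<and> t i \<le> hi) \<and>
        (\<forall>i<n. \<forall>j<n. i \<noteq> j \<longrightarrow> t i \<le> s j \<or> t j \<le> s i) \<and>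
        (\<Sum>i<n. t i - s i) < \<delta>
        \<longrightarrow> (\<Sum>i<n. \<bar>f (t i) - f (s i)\<bar>) < \<epsilon>)"

definition bvp_solution ::
  "real \<Rightarrow> real \<Rightarrow> real \<Rightarrow> real \<Rightarrow> real \<Rightarrow> (real \<Rightarrow> real) \<Rightarrow> (real \<Rightarrow> real)
   \<Rightarrow> (real \<Rightarrow> real) \<Rightarrow> (real \<Rightarrow> real) \<Rightarrow> real \<Rightarrow> (real \<Rightarrow> real) \<Rightarrow> bool" where
  "bvp_solution L \<alpha> \<beta> \<gamma> \<delta> a g b k \<mu> u \<longleftrightarrow>
     (\<forall>x\<in>{0..L}. u x \<ge> 0) \<and>
     (\<exists>v. abs_continuous_on 0 L u \<and> abs_continuous_on 0 L v \<and>
        (AE x in lborel. x \<in> {0..L} \<longrightarrow> (u has_real_derivative v x) (at x)) \<and>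
        (AE x in lborel. x \<in> {0..L} \<longrightarrow>
            (\<exists>w. (v has_real_derivative w) (at x) \<and>
                 w + a x * g (u x) - \<mu> * b x * k (u x) = 0)) \<and>
        \<alpha> * u 0 - \<beta> * v 0 = 0 \<and> \<gamma> * u L + \<delta> * v L = 0)"

definition positive_on_open :: "real \<Rightarrow> (real \<Rightarrow> real) \<Rightarrow> bool" where
  "positive_on_open L u \<longleftrightarrow> (\<forall>x\<in>{0<..<L}. u x > 0)"

end

theory Submission
  imports Defs "HOL-Complex_Analysis.Great_Picard"
begin

text \<open>
  Shoot from the left endpoint with \<open>u 0 = \<beta> * s\<close>, \<open>u' 0 = \<alpha> * s\<close> and follow the sign of
  \<open>\<gamma> * u L + \<delta> * u' L\<close> as \<open>s\<close> grows; a shot that reaches zero in \<open>]0,L[\<close> continues along a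
  straight line with negative slope. The value is positive for very small \<open>s\<close>. It is negative at
  some moderate \<open>s1\<close> when \<open>\<mu>\<close> is large: the convex part on \<open>[\<tau>,\<sigma>]\<close> throws \<open>u\<close> so high that the
  superlinear concave part brings it down to zero before \<open>L\<close>. It is negative at some large \<open>s2\<close>,
  because then \<open>u\<close> vanishes already before \<open>\<tau>\<close>. Between \<open>s1\<close> and \<open>s2\<close> the slope at \<open>\<sigma>\<close> takes a
  prescribed small value \<open>r > 0\<close>; for large \<open>\<mu>\<close> this forces \<open>u \<sigma>\<close> to be small as well, so that
  \<open>u\<close> stays increasing on \<open>[\<sigma>,L]\<close> and the value is positive. The four signs give three zeros.

  As \<open>g\<close> and \<open>k\<close> are only continuous, initial value problems need not be uniquely solvable. The
  intermediate value argument is therefore applied to Tonelli's delayed approximations, which depend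
  continuously on \<open>s\<close>, and the three zeros survive the passage to the limit because the sign
  conditions hold for every exact solution; the last two are told apart by \<open>u' \<sigma> \<ge> r\<close> and
  \<open>u' \<sigma> \<le> r\<close>. The nonlinearity \<open>k\<close> is truncated at an a priori bound that does not depend on \<open>\<mu>\<close>.
\<close>

section \<open>Delayed initial value problems\<close>

text \<open>Substitution moves the variable endpoint into the integrand over a fixed interval, where
  parametric continuity theorems apply. The factor \<open>max 0 x\<close> keeps the identity true
  for negative \<open>x\<close>, where \<open>{0..x}\<close> is empty.\<close>

lemma integral_0_eq_stretch:
  fixes f :: "real \<Rightarrow> real"
  assumes "continuous_on UNIV f"
  shows "integral {0..x} f = max 0 x * integral {0..1} (\<lambda>t. f (max 0 x * t))"
proof (cases "x > 0")
  case True
  have im: "(\<lambda>t. t / x) ` {0..x} = {0..1}"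
    using True by simp
  show ?thesis
    using integral_stretch_real[of x 0 x f] True unfolding im by simp
next
  case False
  then consider "x = 0" | "x < 0" by linarith
  then show ?thesis by cases auto
qed

text \<open>Joint continuity in parameter and endpoint: after the rescaling above, both enter only
  through a continuous integrand on the compact interval \<open>[0,1]\<close>.\<close>

lemma continuous_on_integral_upper:
  fixes f :: "'a::topological_space \<Rightarrow> real \<Rightarrow> real"
  assumes "continuous_on UNIV (\<lambda>(z, t). f z t)"
  shows "continuous_on UNIV (\<lambda>(z, x). integral {0..x} (f z))"
proof -
  have c: "continuous_on S (\<lambda>y. f (p y) (q y))" if "continuous_on S p" "continuous_on S q"
    for S :: "'b::topological_space set" and p q
    using continuous_on_compose2[OF assms continuous_on_Pair[OF that]] by simp
  have "continuous_on (UNIV \<times> cbox 0 1)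
          (\<lambda>(zx, t). (\<lambda>(z, x). \<lambda>t. f z (max 0 x * t)) (zx :: 'a \<times> real) (t::real))"
    unfolding split_def
    by (intro continuous_intros c)
  then have "continuous_on UNIV
          (\<lambda>zx :: 'a \<times> real. integral (cbox 0 1) ((\<lambda>(z, x). \<lambda>t::real. f z (max 0 x * t)) zx))"
    by (rule integral_continuous_on_param)
  then have "continuous_on UNIV (\<lambda>zx :: 'a \<times> real. max 0 (snd zx) *
               integral (cbox 0 1) ((\<lambda>(z, x). \<lambda>t::real. f z (max 0 x * t)) zx))"
    by (intro continuous_intros)
  moreover have "(\<lambda>zx :: 'a \<times> real. max 0 (snd zx) *
       integral (cbox 0 1) ((\<lambda>(z, x). \<lambda>t::real. f z (max 0 x * t)) zx)) = (\<lambda>(z, x). integral {0..x} (f z))"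
  proof (rule ext, clarify)
    fix z :: 'a and x :: real
    have "continuous_on UNIV (f z)"
      using c[OF continuous_on_const continuous_on_id, of UNIV z] by simp
    from integral_0_eq_stretch[OF this, of x]
    show "max 0 (snd (z, x)) * integral (cbox 0 1) (\<lambda>t. f z (max 0 x * t)) = integral {0..x} (f z)"
      by simp
  qed
  ultimately show ?thesis by (simp only:)
qed

lemma integral_0_Lipschitz:
  fixes f :: "real \<Rightarrow> real"
  assumes "continuous_on {0..L} f" "\<And>t. t \<in> {0..L} \<Longrightarrow> \<bar>f t\<bar> \<le> C"
    and "x \<in> {0..L}" "y \<in> {0..L}"
  shows "\<bar>integral {0..x} f - integral {0..y} f\<bar> \<le> C * \<bar>x - y\<bar>"
proof -
  have *: "\<bar>integral {0..x} f - integral {0..y} f\<bar> \<le> C * \<bar>x - y\<bar>"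
    if "y \<le> x" "x \<in> {0..L}" "y \<in> {0..L}" for x y
  proof -
    have "f integrable_on {0..x}"
      using that by (intro integrable_continuous_real continuous_on_subset[OF assms(1)]) auto
    then have "integral {0..y} f + integral {y..x} f = integral {0..x} f"
      using that by (intro Henstock_Kurzweil_Integration.integral_combine) auto
    moreover have "norm (integral {y..x} f) \<le> C * (x - y)"
      using that assms(2) by (intro integral_bound continuous_on_subset[OF assms(1)]) auto
    ultimately show ?thesis using that by simp
  qed
  show ?thesis
    using *[of x y] *[of y x] assms by (cases "y \<le> x") (auto simp: abs_minus_commute)
qed

text \<open>The \<open>j\<close>-th iterate solves the equation with delay \<open>h\<close> exactly on \<open>[0, j * h]\<close>. For negative
  arguments the integrals over \<open>{0..x}\<close> are empty, so the iterates are constant there and no initial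
  history has to be specified.\<close>
primrec delayed_u :: "(real \<Rightarrow> real \<Rightarrow> real) \<Rightarrow> real \<Rightarrow> nat \<Rightarrow> real \<times> real \<Rightarrow> real \<Rightarrow> real" where
  "delayed_u \<phi> h 0 z x = fst z"
| "delayed_u \<phi> h (Suc j) z x =
     fst z + integral {0..x} (\<lambda>t. snd z + integral {0..t} (\<lambda>r. \<phi> r (delayed_u \<phi> h j z (r - h))))"

text \<open>The pair \<open>z\<close> consists of initial value and initial slope. Note the index:
  this is the slope of the iterate \<open>Suc j\<close>, computed from the iterate
  \<open>j\<close>.\<close>

definition delayed_v :: "(real \<Rightarrow> real \<Rightarrow> real) \<Rightarrow> real \<Rightarrow> nat \<Rightarrow> real \<times> real \<Rightarrow> real \<Rightarrow> real" where
  "delayed_v \<phi> h j z x = snd z + integral {0..x} (\<lambda>r. \<phi> r (delayed_u \<phi> h j z (r - h)))"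

lemma delayed_u_Suc: "delayed_u \<phi> h (Suc j) z x = fst z + integral {0..x} (delayed_v \<phi> h j z)"
  unfolding delayed_v_def delayed_u.simps by simp

declare delayed_u.simps(2) [simp del]

text \<open>The delay turns the equation into finitely many explicit integrations, so continuity in
  the initial data follows by induction on \<open>j\<close>. This is the property that exact
  solutions may lack.\<close>

lemma delayed_continuous:
  assumes \<phi>: "continuous_on UNIV (\<lambda>(x, y). \<phi> x y)"
  shows "continuous_on UNIV (\<lambda>(z, x). delayed_u \<phi> h j z x)"
    and "continuous_on UNIV (\<lambda>(z, x). delayed_v \<phi> h j z x)"
proof -
  have c: "continuous_on UNIV (\<lambda>y. \<phi> (p y) (q y))"
    if "continuous_on UNIV p" "continuous_on UNIV q" for p q :: "(real \<times> real) \<times> real \<Rightarrow> real"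
    using continuous_on_compose2[OF \<phi> continuous_on_Pair[OF that]] by simp
  have v: "continuous_on UNIV (\<lambda>(z, x). delayed_v \<phi> h j z x)"
    if "continuous_on UNIV (\<lambda>(z, x). delayed_u \<phi> h j z x)" for j
  proof -
    have "continuous_on UNIV (\<lambda>y :: (real \<times> real) \<times> real. delayed_u \<phi> h j (fst y) (snd y - h))"
    proof -
      have "continuous_on UNIV (\<lambda>y :: (real \<times> real) \<times> real. (fst y, snd y - h))"
        by (intro continuous_intros)
      from continuous_on_compose2[OF that this] show ?thesis by simp
    qed
    then have "continuous_on UNIV (\<lambda>(z :: real \<times> real, r). \<phi> r (delayed_u \<phi> h j z (r - h)))"
      unfolding split_def by (intro c continuous_intros)
    from continuous_on_integral_upper[OF this]
    show ?thesis unfolding delayed_v_def split_def by (intro continuous_intros)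
  qed
  have u: "continuous_on UNIV (\<lambda>(z, x). delayed_u \<phi> h j z x)" for j
  proof (induction j)
    case 0
    show ?case by (auto simp: split_def intro!: continuous_intros)
  next
    case (Suc j)
    from continuous_on_integral_upper[OF v[OF Suc]]
    show ?case unfolding delayed_u_Suc split_def by (intro continuous_intros)
  qed
  show "continuous_on UNIV (\<lambda>(z, x). delayed_u \<phi> h j z x)" by (rule u)
  show "continuous_on UNIV (\<lambda>(z, x). delayed_v \<phi> h j z x)" by (rule v[OF u])
qed

text \<open>Method of steps: for \<open>r \<le> Suc j * h\<close> the delayed argument
  \<open>r - h\<close> is at most \<open>j * h\<close>, where the preceding iterates already agree.
  For \<open>j = 0\<close> only \<open>x \<le> 0\<close> occurs, and the integral is zero.\<close>

lemma delayed_u_stable: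
  assumes "h > 0" "x \<le> j * h"
  shows "delayed_u \<phi> h (Suc j) z x = delayed_u \<phi> h j z x"
  using assms(2)
proof (induction j arbitrary: x)
  case 0
  then have "x = 0 \<or> {0..x} = {}" by auto
  then show ?case by (auto simp: delayed_u_Suc)
next
  case (Suc j)
  have "delayed_v \<phi> h (Suc j) z t = delayed_v \<phi> h j z t" if "t \<in> {0..x}" for t
  proof -
    have "\<phi> r (delayed_u \<phi> h (Suc j) z (r - h)) = \<phi> r (delayed_u \<phi> h j z (r - h))"
      if "r \<in> {0..t}" for r
      using that \<open>t \<in> {0..x}\<close> Suc by (subst Suc.IH) (auto simp: algebra_simps)
    then have "integral {0..t} (\<lambda>r. \<phi> r (delayed_u \<phi> h (Suc j) z (r - h)))
      = integral {0..t} (\<lambda>r. \<phi> r (delayed_u \<phi> h j z (r - h)))"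
      by (intro integral_cong)
    then show ?thesis by (simp add: delayed_v_def)
  qed
  then have "integral {0..x} (delayed_v \<phi> h (Suc j) z) = integral {0..x} (delayed_v \<phi> h j z)"
    by (intro integral_cong)
  then show ?case by (subst (1 2) delayed_u_Suc) simp
qed

section \<open>Tonelli approximations on \<open>[0,L]\<close> and their limits\<close>

text \<open>The number of iterates times the delay is at least \<open>L\<close>, so up to
  \<open>L\<close> the next iterate is the same function. Hence \<open>tonelli_v\<close> is the
  slope of \<open>tonelli_u\<close> there, in spite of the index shift.\<close>

definition tonelli_u :: "(real \<Rightarrow> real \<Rightarrow> real) \<Rightarrow> real \<Rightarrow> nat \<Rightarrow> real \<times> real \<Rightarrow> real \<Rightarrow> real" where
  "tonelli_u \<phi> L n = delayed_u \<phi> (1 / Suc n) (nat \<lceil>L * real (Suc n)\<rceil>)"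

definition tonelli_v :: "(real \<Rightarrow> real \<Rightarrow> real) \<Rightarrow> real \<Rightarrow> nat \<Rightarrow> real \<times> real \<Rightarrow> real \<Rightarrow> real" where
  "tonelli_v \<phi> L n = delayed_v \<phi> (1 / Suc n) (nat \<lceil>L * real (Suc n)\<rceil>)"

lemma tonelli_v_eq:
  "tonelli_v \<phi> L n z x = snd z + integral {0..x} (\<lambda>r. \<phi> r (tonelli_u \<phi> L n z (r - 1 / Suc n)))"
  by (simp add: tonelli_v_def tonelli_u_def delayed_v_def)

lemma tonelli_u_eq:
  assumes "x \<le> L"
  shows "tonelli_u \<phi> L n z x = fst z + integral {0..x} (tonelli_v \<phi> L n z)"
proof -
  have "L * real (Suc n) \<le> real (nat \<lceil>L * real (Suc n)\<rceil>)"
    by linarith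
  moreover have "x * real (Suc n) \<le> L * real (Suc n)"
    using assms by (intro mult_right_mono) auto
  ultimately have "x * real (Suc n) \<le> real (nat \<lceil>L * real (Suc n)\<rceil>)"
    by linarith
  then have "x \<le> real (nat \<lceil>L * real (Suc n)\<rceil>) * (1 / Suc n)"
    by (simp add: pos_le_divide_eq)
  from delayed_u_stable[OF _ this, of \<phi> z] show ?thesis
    unfolding tonelli_u_def tonelli_v_def delayed_u_Suc by simp
qed

lemma tonelli_continuous:
  assumes "continuous_on UNIV (\<lambda>(x, y). \<phi> x y)"
  shows "continuous_on UNIV (\<lambda>z. tonelli_u \<phi> L n z x)" "continuous_on UNIV (\<lambda>z. tonelli_v \<phi> L n z x)"
    and "continuous_on UNIV (tonelli_u \<phi> L n z)" "continuous_on UNIV (tonelli_v \<phi> L n z)"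
proof -
  have *: "continuous_on UNIV (\<lambda>z. (z, x))" "continuous_on UNIV (\<lambda>x. (z, x))"
    for x :: real and z :: "real \<times> real"
    by (intro continuous_intros)+
  note d = delayed_continuous[OF assms, of "1 / Suc n" "nat \<lceil>L * real (Suc n)\<rceil>"]
  show "continuous_on UNIV (\<lambda>z. tonelli_u \<phi> L n z x)" "continuous_on UNIV (\<lambda>z. tonelli_v \<phi> L n z x)"
    "continuous_on UNIV (tonelli_u \<phi> L n z)" "continuous_on UNIV (tonelli_v \<phi> L n z)"
    using continuous_on_compose2[OF d(1) *(1)[of x]] continuous_on_compose2[OF d(2) *(1)[of x]]
      continuous_on_compose2[OF d(1) *(2)[of z]] continuous_on_compose2[OF d(2) *(2)[of z]]
    by (simp_all add: tonelli_u_def tonelli_v_def)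
qed

text \<open>All bounds are uniform in \<open>n\<close>, as compactness requires. The last one
  measures the effect of the delay.\<close>

lemma tonelli_bounds:
  assumes \<phi>: "continuous_on UNIV (\<lambda>(x, y). \<phi> x y)" and C: "\<And>x y. \<bar>\<phi> x y\<bar> \<le> C"
    and z: "norm z \<le> Z" and x: "x \<in> {0..L}" and y: "y \<in> {0..L}"
  shows "\<bar>tonelli_v \<phi> L n z x\<bar> \<le> Z + C * L"
    and "\<bar>tonelli_v \<phi> L n z x - tonelli_v \<phi> L n z y\<bar> \<le> C * \<bar>x - y\<bar>"
    and "\<bar>tonelli_u \<phi> L n z x\<bar> \<le> Z + (Z + C * L) * L"
    and "\<bar>tonelli_u \<phi> L n z x - tonelli_u \<phi> L n z y\<bar> \<le> (Z + C * L) * \<bar>x - y\<bar>"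
    and "\<And>h. h \<ge> 0 \<Longrightarrow> \<bar>tonelli_u \<phi> L n z (x - h) - tonelli_u \<phi> L n z x\<bar> \<le> (Z + C * L) * h"
proof -
  have "C \<ge> 0" using C[of 0 0] by linarith
  have L: "0 \<le> L" using x by auto
  have z': "\<bar>fst z\<bar> \<le> Z" "\<bar>snd z\<bar> \<le> Z"
    using norm_fst_le[of "fst z" "snd z"] norm_snd_le[of "snd z" "fst z"] z by auto
  have "continuous_on UNIV (\<lambda>r. (r, tonelli_u \<phi> L n z (r - 1 / Suc n)))"
    by (intro continuous_intros continuous_on_compose2[OF tonelli_continuous(3)[OF \<phi>]]) auto
  from continuous_on_compose2[OF \<phi> this]
  have "continuous_on {0..L} (\<lambda>r. \<phi> r (tonelli_u \<phi> L n z (r - 1 / Suc n)))"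
    by (auto intro: continuous_on_subset)
  note lip = integral_0_Lipschitz[OF this C]
  have v2: "\<bar>tonelli_v \<phi> L n z x - tonelli_v \<phi> L n z y\<bar> \<le> C * \<bar>x - y\<bar>"
    if "x \<in> {0..L}" "y \<in> {0..L}" for x y
    using lip[of x y] that by (simp add: tonelli_v_eq)
  have v1: "\<bar>tonelli_v \<phi> L n z x\<bar> \<le> Z + C * L" if "x \<in> {0..L}" for x
  proof -
    have "C * x \<le> C * L" using that \<open>C \<ge> 0\<close> by (intro mult_left_mono) auto
    then show ?thesis using lip[of x 0] that z' by (simp add: tonelli_v_eq)
  qed
  have "continuous_on {0..L} (tonelli_v \<phi> L n z)"
    using tonelli_continuous(4)[OF \<phi>] by (rule continuous_on_subset) auto
  note lip = integral_0_Lipschitz[OF this v1]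
  have u2: "\<bar>tonelli_u \<phi> L n z x - tonelli_u \<phi> L n z y\<bar> \<le> (Z + C * L) * \<bar>x - y\<bar>"
    if "x \<in> {0..L}" "y \<in> {0..L}" for x y
    using lip[of x y] that by (simp add: tonelli_u_eq)
  have Z0: "Z + C * L \<ge> 0" using v1[OF x] by linarith
  have u1: "\<bar>tonelli_u \<phi> L n z x\<bar> \<le> Z + (Z + C * L) * L" if "x \<in> {0..L}" for x
  proof -
    have "(Z + C * L) * x \<le> (Z + C * L) * L" using that Z0 by (intro mult_left_mono) auto
    then show ?thesis using lip[of x 0] that z' by (simp add: tonelli_u_eq)
  qed
  show "\<bar>tonelli_u \<phi> L n z (x - h) - tonelli_u \<phi> L n z x\<bar> \<le> (Z + C * L) * h" if "h \<ge> 0" for h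
  proof (cases "x - h \<ge> 0")
    case True
    then show ?thesis using u2[of "x - h" x] x that by auto
  next
    case False
    \<comment> \<open>At a negative argument the integral is empty and the initial value remains;
      moreover \<open>x < h\<close>.\<close>
    then have "tonelli_u \<phi> L n z (x - h) = tonelli_u \<phi> L n z 0"
      using L x that by (simp add: tonelli_u_eq)
    moreover have "(Z + C * L) * x \<le> (Z + C * L) * h" using False Z0 by (intro mult_left_mono) auto
    ultimately show ?thesis using u2[of 0 x] x by auto
  qed
  show "\<bar>tonelli_v \<phi> L n z x\<bar> \<le> Z + C * L"
    "\<bar>tonelli_v \<phi> L n z x - tonelli_v \<phi> L n z y\<bar> \<le> C * \<bar>x - y\<bar>"
    "\<bar>tonelli_u \<phi> L n z x\<bar> \<le> Z + (Z + C * L) * L"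
    "\<bar>tonelli_u \<phi> L n z x - tonelli_u \<phi> L n z y\<bar> \<le> (Z + C * L) * \<bar>x - y\<bar>"
    using v1 v2 u1 u2 x y by blast+
qed

definition ivp_solution :: "(real \<Rightarrow> real \<Rightarrow> real) \<Rightarrow> real \<Rightarrow> real \<times> real \<Rightarrow> (real \<Rightarrow> real) \<Rightarrow> (real \<Rightarrow> real) \<Rightarrow> bool" where
  "ivp_solution \<phi> L z u v \<longleftrightarrow> (u 0, v 0) = z \<and>
     (\<forall>x\<in>{0..L}. (u has_real_derivative v x) (at x within {0..L})) \<and>
     (\<forall>x\<in>{0..L}. (v has_real_derivative \<phi> x (u x)) (at x within {0..L}))"

text \<open>Peano's existence argument with moving initial data: extract a convergent subsequence of
  the data, then apply Arzela-Ascoli to value and slope together, and pass to the limit in both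
  integral equations by dominated convergence. The index sequence \<open>m\<close> allows a start
  from approximations already selected.\<close>

lemma tonelli_limit:
  fixes Q :: "(real \<times> real) set"
  assumes \<phi>: "continuous_on UNIV (\<lambda>(x, y). \<phi> x y)" and C: "\<And>x y. \<bar>\<phi> x y\<bar> \<le> C"
    and L: "L > 0" and Q: "compact Q" "\<And>n. z n \<in> Q" and m: "strict_mono m"
  obtains r z0 u v where "strict_mono (r :: nat \<Rightarrow> nat)" "z0 \<in> Q" "(\<lambda>n. z (r n)) \<longlonglongrightarrow> z0"
    "ivp_solution \<phi> L z0 u v"
    "\<And>x. x \<in> {0..L} \<Longrightarrow> (\<lambda>n. tonelli_u \<phi> L (m (r n)) (z (r n)) x) \<longlonglongrightarrow> u x"
    "\<And>x. x \<in> {0..L} \<Longrightarrow> (\<lambda>n. tonelli_v \<phi> L (m (r n)) (z (r n)) x) \<longlonglongrightarrow> v x"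
proof -
  obtain z0 r1 where r1: "strict_mono (r1 :: nat \<Rightarrow> nat)" "z0 \<in> Q" "(z \<circ> r1) \<longlonglongrightarrow> z0"
    using Q by (meson seq_compactE compact_imp_seq_compact)
  obtain Z where Z: "\<And>y. y \<in> Q \<Longrightarrow> norm y \<le> Z"
    using compact_imp_bounded[OF Q(1)] unfolding bounded_iff by blast
  define U where "U n = tonelli_u \<phi> L (m (r1 n)) (z (r1 n))" for n
  define V where "V n = tonelli_v \<phi> L (m (r1 n)) (z (r1 n))" for n
  define M where "M = Z + C * L"
  have bnd: "\<bar>V n x\<bar> \<le> M" "\<bar>V n x - V n y\<bar> \<le> C * \<bar>x - y\<bar>" "\<bar>U n x\<bar> \<le> Z + M * L"
    "\<bar>U n x - U n y\<bar> \<le> M * \<bar>x - y\<bar>" "h \<ge> 0 \<Longrightarrow> \<bar>U n (x - h) - U n x\<bar> \<le> M * h"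
    if "x \<in> {0..L}" "y \<in> {0..L}" for n x y h
    using tonelli_bounds[OF \<phi> C Z[OF Q(2)[of "r1 n"]] that, where n = "m (r1 n)"]
    by (auto simp: U_def V_def M_def)
  have C0: "C \<ge> 0" using C[of 0 0] by linarith
  have M0: "M \<ge> 0" using bnd(1)[of 0 0 0] L by force
  obtain g k where k: "strict_mono (k :: nat \<Rightarrow> nat)" and
    g: "\<And>e. 0 < e \<Longrightarrow> \<exists>N. \<forall>n x. n \<ge> N \<and> x \<in> {0..L} \<longrightarrow> norm ((U (k n) x, V (k n) x) - g x) < e"
  proof (rule Arzela_Ascoli[of "{0..L}" "\<lambda>n x. (U n x, V n x)" "(Z + M * L) + M"])
    show "norm (U n x, V n x) \<le> Z + M * L + M" if "x \<in> {0..L}" for n x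
      using norm_Pair_le[of "U n x" "V n x"] bnd(1,3)[OF that that, of n] by simp
    show "\<exists>d>0. \<forall>n y. y \<in> {0..L} \<and> norm (x - y) < d \<longrightarrow> norm ((U n x, V n x) - (U n y, V n y)) < e"
      if "x \<in> {0..L}" "0 < e" for x e
    \<comment> \<open>The denominator collects the Lipschitz constants \<open>M\<close> of
      \<open>U n\<close> and \<open>C\<close> of \<open>V n\<close>; the summand \<open>1\<close>
      keeps it positive.\<close>
    proof (intro exI[of _ "e / (M + C + 1)"] conjI allI impI)
      show "e / (M + C + 1) > 0" using that M0 C0 by simp
      fix n y assume y: "y \<in> {0..L} \<and> norm (x - y) < e / (M + C + 1)"
      then have "(M + C + 1) * \<bar>x - y\<bar> < e" using M0 C0 by (simp add: field_simps)
      moreover have "norm ((U n x, V n x) - (U n y, V n y)) \<le> M * \<bar>x - y\<bar> + C * \<bar>x - y\<bar>"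
        using norm_Pair_le[of "U n x - U n y" "V n x - V n y"] bnd(2,4)[of x y n] y that by simp
      moreover have "M * \<bar>x - y\<bar> + C * \<bar>x - y\<bar> \<le> (M + C + 1) * \<bar>x - y\<bar>"
        by (simp add: algebra_simps)
      ultimately show "norm ((U n x, V n x) - (U n y, V n y)) < e" by linarith
    qed
  qed auto
  define u where "u x = fst (g x)" for x
  define v where "v x = snd (g x)" for x
  have lim: "(\<lambda>n. (U (k n) x, V (k n) x)) \<longlonglongrightarrow> g x" if "x \<in> {0..L}" for x
    using g that unfolding LIMSEQ_iff by meson
  have ulim: "(\<lambda>n. U (k n) x) \<longlonglongrightarrow> u x" and vlim: "(\<lambda>n. V (k n) x) \<longlonglongrightarrow> v x" if "x \<in> {0..L}" for x
    using tendsto_fst[OF lim[OF that]] tendsto_snd[OF lim[OF that]] by (simp_all add: u_def v_def)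
  define N where "N n = m (r1 (k n))" for n
  have N: "strict_mono N"
    using m r1(1) k by (simp add: N_def strict_mono_def)
  have zlim: "(\<lambda>n. z (r1 (k n))) \<longlonglongrightarrow> z0"
    using LIMSEQ_subseq_LIMSEQ[OF r1(3) k] by (simp add: o_def)
  have hlim: "(\<lambda>n. 1 / Suc (N n)) \<longlonglongrightarrow> 0"
    using LIMSEQ_subseq_LIMSEQ[OF LIMSEQ_Suc[OF lim_1_over_n] N] by (simp add: o_def)
  \<comment> \<open>The delay tends to zero and the slopes are uniformly bounded, so the delayed
    values have the same limit.\<close>
  have udel: "(\<lambda>n. U (k n) (x - 1 / Suc (N n))) \<longlonglongrightarrow> u x" if x: "x \<in> {0..L}" for x
  proof -
    have "(\<lambda>n. U (k n) (x - 1 / Suc (N n)) - U (k n) x) \<longlonglongrightarrow> 0"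
    proof (rule Lim_null_comparison)
      show "\<forall>\<^sub>F n in sequentially. norm (U (k n) (x - 1 / Suc (N n)) - U (k n) x) \<le> M * (1 / Suc (N n))"
        unfolding real_norm_def by (intro always_eventually allI bnd(5)[OF x x]) simp
      show "(\<lambda>n. M * (1 / Suc (N n))) \<longlonglongrightarrow> 0"
        using tendsto_mult_left[OF hlim, of M] by simp
    qed
    from tendsto_add[OF this ulim[OF x]] show ?thesis by simp
  qed
  have cU: "continuous_on S (U n)" "continuous_on S (V n)" for n S
    unfolding U_def V_def
    by (rule continuous_on_subset[OF tonelli_continuous(3)[OF \<phi>] subset_UNIV],
        rule continuous_on_subset[OF tonelli_continuous(4)[OF \<phi>] subset_UNIV])
  have cu: "continuous_on {0..L} u"
  proof -
    have "\<bar>u x - u y\<bar> \<le> M * \<bar>x - y\<bar>" if "x \<in> {0..L}" "y \<in> {0..L}" for x y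
      using bnd(4)[OF that]
      by (intro tendsto_upperbound[OF tendsto_rabs[OF tendsto_diff[OF ulim[OF that(1)] ulim[OF that(2)]]]]) auto
    then have "M-lipschitz_on {0..L} u"
      using M0 by (intro lipschitz_onI) (auto simp: dist_real_def)
    then show ?thesis by (rule lipschitz_on_continuous_on)
  qed
  have cv: "continuous_on {0..L} v"
  proof -
    have "\<bar>v x - v y\<bar> \<le> C * \<bar>x - y\<bar>" if "x \<in> {0..L}" "y \<in> {0..L}" for x y
      using bnd(2)[OF that]
      by (intro tendsto_upperbound[OF tendsto_rabs[OF tendsto_diff[OF vlim[OF that(1)] vlim[OF that(2)]]]]) auto
    then have "C-lipschitz_on {0..L} v"
      using C0 by (intro lipschitz_onI) (auto simp: dist_real_def)
    then show ?thesis by (rule lipschitz_on_continuous_on)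
  qed
  have cont\<phi>: "continuous_on S (\<lambda>x. \<phi> x (w x))" if "continuous_on S w" for w S
    using continuous_on_compose2[OF \<phi> continuous_on_Pair[OF continuous_on_id that]] by simp
  have cdel: "continuous_on S (\<lambda>r. \<phi> r (U (k n) (r - 1 / Suc (N n))))" for n S
    by (intro cont\<phi> continuous_on_compose2[OF cU(1)[of UNIV "k n"]] continuous_intros) auto
  have uint: "u x = fst z0 + integral {0..x} v" if x: "x \<in> {0..L}" for x
  proof (rule LIMSEQ_unique[OF ulim[OF x]])
    have "(\<lambda>n. integral {0..x} (V (k n))) \<longlonglongrightarrow> integral {0..x} v"
      by (rule dominated_convergence(2)[where h = "\<lambda>_. M"])
        (use x bnd(1)[OF _ x] vlim in \<open>auto intro!: integrable_continuous_real cU\<close>)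
    from tendsto_add[OF tendsto_fst[OF zlim] this]
    show "(\<lambda>n. U (k n) x) \<longlonglongrightarrow> fst z0 + integral {0..x} v"
      using x by (simp add: U_def V_def tonelli_u_eq)
  qed
  have vint: "v x = snd z0 + integral {0..x} (\<lambda>r. \<phi> r (u r))" if x: "x \<in> {0..L}" for x
  proof (rule LIMSEQ_unique[OF vlim[OF x]])
    have "(\<lambda>n. \<phi> r (U (k n) (r - 1 / Suc (N n)))) \<longlonglongrightarrow> \<phi> r (u r)" if "r \<in> {0..x}" for r
      using continuous_on_tendsto_compose[OF \<phi> tendsto_Pair[OF tendsto_const udel[of r]], of r] that x by simp
    then have "(\<lambda>n. integral {0..x} (\<lambda>r. \<phi> r (U (k n) (r - 1 / Suc (N n))))) \<longlonglongrightarrow> integral {0..x} (\<lambda>r. \<phi> r (u r))"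
      by (intro dominated_convergence(2)[where h = "\<lambda>_. C"])
        (use C integrable_continuous_real[OF cdel] in auto)
    from tendsto_add[OF tendsto_snd[OF zlim] this]
    show "(\<lambda>n. V (k n) x) \<longlonglongrightarrow> snd z0 + integral {0..x} (\<lambda>r. \<phi> r (u r))"
      by (simp add: U_def V_def N_def tonelli_v_eq)
  qed
  have "ivp_solution \<phi> L z0 u v"
    unfolding ivp_solution_def
  proof (intro conjI ballI)
    show "(u 0, v 0) = z0" using uint[of 0] vint[of 0] L by simp
    fix x assume x: "x \<in> {0..L}"
    have "((\<lambda>x. fst z0 + integral {0..x} v) has_real_derivative 0 + v x) (at x within {0..L})"
      by (intro DERIV_add DERIV_const integral_has_real_derivative[OF cv x])
    then show "(u has_real_derivative v x) (at x within {0..L})"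
      unfolding add_0_left by (rule has_field_derivative_transform_within[where d = 1]) (use x uint in auto)
    have "((\<lambda>x. snd z0 + integral {0..x} (\<lambda>r. \<phi> r (u r))) has_real_derivative 0 + \<phi> x (u x)) (at x within {0..L})"
      by (intro DERIV_add DERIV_const integral_has_real_derivative[OF cont\<phi>[OF cu] x])
    then show "(v has_real_derivative \<phi> x (u x)) (at x within {0..L})"
      unfolding add_0_left by (rule has_field_derivative_transform_within[where d = 1]) (use x vint in auto)
  qed
  moreover have "strict_mono (\<lambda>n. r1 (k n))"
    using r1(1) k by (simp add: strict_mono_def)
  ultimately show ?thesis
    using r1(2) zlim ulim vlim
    by (intro that[of "\<lambda>n. r1 (k n)" z0 u v]) (auto simp: U_def V_def)
qed

section \<open>Second-order equations on an interval\<close>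

lemma mvt_within:
  fixes f :: "real \<Rightarrow> real"
  assumes "p < q" "{p..q} \<subseteq> S" "\<And>x. x \<in> {p..q} \<Longrightarrow> (f has_real_derivative f' x) (at x within S)"
  obtains \<xi> where "p < \<xi>" "\<xi> < q" "f q - f p = f' \<xi> * (q - p)"
proof -
  have "(f has_derivative (*) (f' x)) (at x within {p..q})" if "p \<le> x" "x \<le> q" for x
    using assms(3)[of x] that DERIV_subset[OF _ assms(2)] by (auto simp: has_field_derivative_def)
  from mvt_simple[OF assms(1) this] that show ?thesis by auto
qed

lemma increment_ge:
  fixes f :: "real \<Rightarrow> real"
  assumes "p \<le> q" "{p..q} \<subseteq> S" "\<And>x. x \<in> {p..q} \<Longrightarrow> (f has_real_derivative f' x) (at x within S)"
    and "\<And>x. x \<in> {p..q} \<Longrightarrow> c \<le> f' x"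
  shows "c * (q - p) \<le> f q - f p"
proof (cases "p = q")
  case False
  then have "p < q" using assms(1) by simp
  then obtain \<xi> where "p < \<xi>" "\<xi> < q" "f q - f p = f' \<xi> * (q - p)"
    using mvt_within[OF _ assms(2,3)] by blast
  then show ?thesis using assms(4)[of \<xi>] by (auto intro!: mult_right_mono)
qed simp

lemma increment_le:
  fixes f :: "real \<Rightarrow> real"
  assumes "p \<le> q" "{p..q} \<subseteq> S" "\<And>x. x \<in> {p..q} \<Longrightarrow> (f has_real_derivative f' x) (at x within S)"
    and "\<And>x. x \<in> {p..q} \<Longrightarrow> f' x \<le> c"
  shows "f q - f p \<le> c * (q - p)"
proof -
  have "((\<lambda>x. - f x) has_real_derivative - f' x) (at x within S)" if "x \<in> {p..q}" for x
    using assms(3)[OF that] by (rule DERIV_minus)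
  from increment_ge[OF assms(1,2) this, of "- c"] assms(4) show ?thesis by simp
qed

text \<open>Gronwall's argument for \<open>E = w^2 + z^2\<close>: the estimate
  \<open>2 * \<bar>w\<bar> * \<bar>z\<bar> \<le> E\<close> gives
  \<open>\<bar>E'\<bar> \<le> (1 + C) * E\<close>. It works in both directions of \<open>x\<close>,
  so zero data at one point force \<open>w\<close> to vanish throughout.\<close>

lemma second_order_energy_bound:
  fixes w z \<psi> :: "real \<Rightarrow> real"
  assumes w: "\<And>x. x \<in> {p..q} \<Longrightarrow> (w has_real_derivative z x) (at x within {p..q})"
    and z: "\<And>x. x \<in> {p..q} \<Longrightarrow> (z has_real_derivative \<psi> x) (at x within {p..q})"
    and le: "\<And>x. x \<in> {p..q} \<Longrightarrow> \<bar>\<psi> x\<bar> \<le> C * \<bar>w x\<bar>"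
    and C: "C \<ge> 0" and x0: "x0 \<in> {p..q}" and x: "x \<in> {p..q}"
  shows "(w x)\<^sup>2 + (z x)\<^sup>2 \<le> ((w x0)\<^sup>2 + (z x0)\<^sup>2) * exp ((1 + C) * \<bar>x - x0\<bar>)"
proof -
  define E where "E x = (w x)\<^sup>2 + (z x)\<^sup>2" for x
  define E' where "E' x = 2 * w x * z x + 2 * z x * \<psi> x" for x
  define D where "D = 1 + C"
  have E: "(E has_real_derivative E' x) (at x within {p..q})" if "x \<in> {p..q}" for x
    unfolding E_def E'_def
    by (auto intro!: derivative_eq_intros w z that simp: algebra_simps)
  have E': "\<bar>E' x\<bar> \<le> D * E x" if "x \<in> {p..q}" for x
  proof -
    have "2 * \<bar>w x\<bar> * \<bar>z x\<bar> \<le> E x"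
      using sum_squares_bound[of "\<bar>w x\<bar>" "\<bar>z x\<bar>"] by (simp add: E_def)
    then have "D * (2 * \<bar>w x\<bar> * \<bar>z x\<bar>) \<le> D * E x"
      using C by (intro mult_left_mono) (auto simp: D_def)
    moreover have "\<bar>z x\<bar> * \<bar>\<psi> x\<bar> \<le> \<bar>z x\<bar> * (C * \<bar>w x\<bar>)"
      using le[OF that] by (intro mult_left_mono) auto
    moreover have "\<bar>E' x\<bar> \<le> 2 * \<bar>w x\<bar> * \<bar>z x\<bar> + 2 * (\<bar>z x\<bar> * \<bar>\<psi> x\<bar>)"
      unfolding E'_def by (rule order_trans[OF abs_triangle_ineq]) (simp add: abs_mult)
    ultimately show ?thesis by (simp add: D_def algebra_simps)
  qed
  \<comment> \<open>Forward direction: \<open>E\<close> times the decaying exponential is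
    nonincreasing. The backward direction uses the growing exponential.\<close>
  have "E x * exp (- D * (x - y)) \<le> E y" if "y \<le> x" "x \<in> {p..q}" "y \<in> {p..q}" for x y
  proof -
    have d: "((\<lambda>t. E t * exp (- D * (t - y))) has_real_derivative (E' t - D * E t) * exp (- D * (t - y)))
         (at t within {p..q})" if "t \<in> {y..x}" for t
      using that \<open>x \<in> {p..q}\<close> \<open>y \<in> {p..q}\<close>
      by (auto intro!: derivative_eq_intros E simp: algebra_simps)
    have "E x * exp (- D * (x - y)) - E y * exp (- D * (y - y)) \<le> 0 * (x - y)"
    proof (rule increment_le[OF \<open>y \<le> x\<close> _ d])
      show "(E' t - D * E t) * exp (- D * (t - y)) \<le> 0" if "t \<in> {y..x}" for t
        using E'[of t] that \<open>x \<in> {p..q}\<close> \<open>y \<in> {p..q}\<close> by (intro mult_nonpos_nonneg) auto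
    qed (use that in auto)
    then show ?thesis by simp
  qed
  moreover have "E x * exp (- D * (y - x)) \<le> E y" if "x \<le> y" "x \<in> {p..q}" "y \<in> {p..q}" for x y
  proof -
    have d: "((\<lambda>t. E t * exp (D * (t - y))) has_real_derivative (E' t + D * E t) * exp (D * (t - y)))
         (at t within {p..q})" if "t \<in> {x..y}" for t
      using that \<open>x \<in> {p..q}\<close> \<open>y \<in> {p..q}\<close>
      by (auto intro!: derivative_eq_intros E simp: algebra_simps)
    have "0 * (y - x) \<le> E y * exp (D * (y - y)) - E x * exp (D * (x - y))"
    proof (rule increment_ge[OF \<open>x \<le> y\<close> _ d])
      show "0 \<le> (E' t + D * E t) * exp (D * (t - y))" if "t \<in> {x..y}" for t
        using E'[of t] that \<open>x \<in> {p..q}\<close> \<open>y \<in> {p..q}\<close> by (intro mult_nonneg_nonneg) auto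
    qed (use that in auto)
    then show ?thesis by (simp add: algebra_simps)
  qed
  ultimately have "E x * exp (- (D * \<bar>x - x0\<bar>)) \<le> E x0"
    using x x0 by (cases "x0 \<le> x") auto
  then have "E x \<le> E x0 * exp (D * \<bar>x - x0\<bar>)"
    by (simp add: exp_minus field_simps)
  then show ?thesis by (simp add: E_def D_def)
qed

lemma ivp_solution_subinterval:
  assumes "ivp_solution \<phi> L z u v" "0 \<le> p" "q \<le> L" "x \<in> {p..q}"
  shows "(u has_real_derivative v x) (at x within {p..q})"
    "(v has_real_derivative \<phi> x (u x)) (at x within {p..q})"
proof -
  have "x \<in> {0..L}" "{p..q} \<subseteq> {0..L}" using assms by auto
  then show "(u has_real_derivative v x) (at x within {p..q})"
    "(v has_real_derivative \<phi> x (u x)) (at x within {p..q})"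
    using assms(1) unfolding ivp_solution_def by (blast intro: DERIV_subset)+
qed

text \<open>The linear bound makes \<open>\<phi>\<close> vanish for \<open>y \<le> 0\<close> and
  excludes a zero with zero slope. The solution therefore crosses its first zero transversally, and
  below zero the equation is \<open>u'' = 0\<close>.\<close>

lemma ivp_solution_after_zero:
  assumes sol: "ivp_solution \<phi> L (p, q) u v"
    and lin: "\<And>Y. \<exists>C\<ge>0. \<forall>x\<in>{0..L}. \<forall>y\<le>Y. \<bar>\<phi> x y\<bar> \<le> C * max 0 y"
    and init: "p \<ge> 0" "q \<ge> 0" "p > 0 \<or> q > 0"
    and x0: "0 < x0" "x0 \<le> L" "u x0 \<le> 0"
  obtains x1 where "0 < x1" "x1 \<le> x0" "v x1 < 0" "\<And>x. x \<in> {x1..L} \<Longrightarrow> u x = v x1 * (x - x1)"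
    "\<And>x. x \<in> {x1..L} \<Longrightarrow> v x = v x1"
proof -
  have u0: "u 0 = p" "v 0 = q" using sol by (auto simp: ivp_solution_def)
  note du = ivp_solution_subinterval(1)[OF sol]
  note dv = ivp_solution_subinterval(2)[OF sol]
  have cu: "continuous_on {0..L} u" and cv: "continuous_on {0..L} v"
    by (rule DERIV_continuous_on[OF du] DERIV_continuous_on[OF dv]; simp)+
  obtain Y where Y: "\<And>x. x \<in> {0..L} \<Longrightarrow> u x \<le> Y"
    using continuous_attains_sup[OF _ _ cu] x0 by force
  obtain C where C: "C \<ge> 0" "\<And>x y. x \<in> {0..L} \<Longrightarrow> y \<le> Y \<Longrightarrow> \<bar>\<phi> x y\<bar> \<le> C * max 0 y"
    using lin[of Y] by blast
  have nz: "v x \<noteq> 0" if "x \<in> {0..L}" "u x = 0" for x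
  proof
    assume "v x = 0"
    have "(u 0)\<^sup>2 + (v 0)\<^sup>2 \<le> ((u x)\<^sup>2 + (v x)\<^sup>2) * exp ((1 + C) * \<bar>0 - x\<bar>)"
    proof (rule second_order_energy_bound[OF du dv _ C(1) that(1)])
      show "\<bar>\<phi> t (u t)\<bar> \<le> C * \<bar>u t\<bar>" if "t \<in> {0..L}" for t
        by (rule order_trans[OF C(2)[OF that Y[OF that]]]) (intro mult_left_mono C(1), simp)
    qed (use x0 in auto)
    then have "p\<^sup>2 + q\<^sup>2 \<le> 0" using that \<open>v x = 0\<close> u0 by simp
    then show False using init(3) by (simp add: sum_power2_le_zero_iff)
  qed
  \<comment> \<open>If \<open>p = 0\<close> the solution starts at zero, so the search for the first
    zero has to begin slightly to the right, where the slope \<open>q > 0\<close> has made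
    \<open>u\<close> positive.\<close>
  obtain y where y: "0 \<le> y" "y < x0" "u y > 0"
  proof (cases "p > 0")
    case True
    then show ?thesis using that[of 0] u0 x0 by simp
  next
    case False
    then have q: "p = 0" "q > 0" using init by auto
    have "(u has_real_derivative v 0) (at 0 within {0..L})" using du[of 0 L 0] x0 by simp
    then obtain d where d: "d > 0" "\<And>h. 0 < h \<Longrightarrow> 0 + h \<in> {0..L} \<Longrightarrow> h < d \<Longrightarrow> u 0 < u (0 + h)"
      using has_real_derivative_pos_inc_right[of u "v 0" 0 "{0..L}"] q u0 by auto
    show ?thesis
      using that[of "min (d / 2) (x0 / 2)"] d(1) d(2)[of "min (d / 2) (x0 / 2)"] x0 q u0 by auto
  qed
  define x1 where "x1 = Inf {x \<in> {y..x0}. u x \<le> 0}"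
  have cl: "closed {x \<in> {y..x0}. u x \<le> 0}"
    by (intro continuous_on_closed_Collect_le continuous_on_subset[OF cu] continuous_intros)
      (use y x0 in auto)
  have ne: "x0 \<in> {x \<in> {y..x0}. u x \<le> 0}" using x0 y by auto
  have bb: "bdd_below {x \<in> {y..x0}. u x \<le> 0}" by (rule bdd_belowI[of _ y]) auto
  have x1: "x1 \<in> {x \<in> {y..x0}. u x \<le> 0}"
    unfolding x1_def using closed_contains_Inf[OF _ bb cl] ne by blast
  have before: "u x > 0" if "y \<le> x" "x < x1" for x
  proof (rule ccontr)
    assume "\<not> u x > 0"
    then have "x1 \<le> x" unfolding x1_def using that x1 by (intro cInf_lower[OF _ bb]) auto
    then show False using that by simp
  qed
  have yx1: "y < x1" using x1 y by (cases "y = x1") auto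
  have ux1: "u x1 = 0"
  proof (rule ccontr)
    assume "u x1 \<noteq> 0"
    then have "u x1 < 0" using x1 by auto
    then obtain t where "y \<le> t" "t \<le> x1" "u t = 0"
      using IVT2'[of u x1 0 y] y yx1 continuous_on_subset[OF cu, of "{y..x1}"] x1 x0 by force
    then show False using before[of t] \<open>u x1 < 0\<close> by (cases "t = x1") auto
  qed
  have "v x1 \<le> 0"
  proof (rule ccontr)
    assume "\<not> v x1 \<le> 0"
    moreover have "(u has_real_derivative v x1) (at x1 within {0..L})" using du[of 0 L x1] x1 y x0 by simp
    ultimately obtain d where d: "d > 0" "\<And>h. 0 < h \<Longrightarrow> x1 - h \<in> {0..L} \<Longrightarrow> h < d \<Longrightarrow> u (x1 - h) < u x1"
      using has_real_derivative_pos_inc_left[of u "v x1" x1 "{0..L}"] by force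
    define h where "h = min (d / 2) (x1 - y)"
    have h: "0 < h" "h < d" "h \<le> x1 - y"
      using d(1) yx1 by (auto simp: h_def min_less_iff_disj)
    have "u (x1 - h) < 0" using d(2)[of h] h y x1 x0 ux1 by auto
    moreover have "u (x1 - h) > 0" using before[of "x1 - h"] h by auto
    ultimately show False by simp
  qed
  then have vx1: "v x1 < 0" using nz[of x1] ux1 x1 x0 y by auto
  \<comment> \<open>Since the linear solution is nonpositive after \<open>x1\<close>, \<open>\<phi>\<close> is controlled by the difference \<open>w\<close>,
    and the energy bound gives \<open>w = 0\<close>.\<close>
  define w where "w x = u x - v x1 * (x - x1)" for x
  define z where "z x = v x - v x1" for x
  have L1: "x1 \<le> L" "0 \<le> x1" using x1 x0 y by auto
  have "(w x)\<^sup>2 + (z x)\<^sup>2 \<le> ((w x1)\<^sup>2 + (z x1)\<^sup>2) * exp ((1 + C) * \<bar>x - x1\<bar>)" if "x \<in> {x1..L}" for x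
  proof (rule second_order_energy_bound[where \<psi> = "\<lambda>x. \<phi> x (u x)" and p = x1 and q = L])
    fix t assume t: "t \<in> {x1..L}"
    show "(w has_real_derivative z t) (at t within {x1..L})"
      unfolding w_def z_def using t L1 by (auto intro!: derivative_eq_intros du)
    show "(z has_real_derivative \<phi> t (u t)) (at t within {x1..L})"
      unfolding z_def using t L1 by (auto intro!: derivative_eq_intros dv)
    have "v x1 * (t - x1) \<le> 0" using vx1 t by (intro mult_nonpos_nonneg) auto
    then have "max 0 (u t) \<le> \<bar>w t\<bar>" by (auto simp: w_def)
    moreover have "\<bar>\<phi> t (u t)\<bar> \<le> C * max 0 (u t)" using t L1 by (intro C(2) Y) auto
    ultimately show "\<bar>\<phi> t (u t)\<bar> \<le> C * \<bar>w t\<bar>" using C(1) by (meson mult_left_mono order_trans)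
  qed (use C that L1 in auto)
  then have "(w x)\<^sup>2 + (z x)\<^sup>2 \<le> 0" if "x \<in> {x1..L}" for x
    using that by (simp add: w_def z_def ux1)
  then have "w x = 0 \<and> z x = 0" if "x \<in> {x1..L}" for x
    using that by (simp add: sum_power2_le_zero_iff)
  then have wz: "u x = v x1 * (x - x1)" "v x = v x1" if "x \<in> {x1..L}" for x
    using that unfolding w_def z_def by (metis eq_iff_diff_eq_0)+
  have "0 < x1" "x1 \<le> x0" using x1 yx1 y(1) by auto
  then show ?thesis
    by (rule that[OF _ _ vx1 wz])
qed

section \<open>An a priori bound where only \<open>a\<close> acts\<close>

text \<open>This is the equation on the outer intervals, where \<open>b\<close> is zero; bounds for
  it cannot depend on \<open>\<mu>\<close>.\<close>

definition nonneg_solution :: "(real \<Rightarrow> real) \<Rightarrow> (real \<Rightarrow> real) \<Rightarrow> real \<Rightarrow> real \<Rightarrow> (real \<Rightarrow> real) \<Rightarrow> (real \<Rightarrow> real) \<Rightarrow> bool" where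
  "nonneg_solution a G p q u v \<longleftrightarrow> (\<forall>x\<in>{p..q}. u x \<ge> 0 \<and> (u has_real_derivative v x) (at x within {p..q}) \<and>
     (v has_real_derivative - a x * G (u x)) (at x within {p..q}))"

text \<open>By concavity \<open>u\<close> is at least a quarter of its maximum on the middle half of the interval. If the
  maximum is large, superlinearity makes the slope drop there by more than concavity allows.\<close>
lemma nonneg_solution_bound:
  fixes a G :: "real \<Rightarrow> real"
  assumes "p < q" and a: "continuous_on {p..q} a" "\<And>x. x \<in> {p..q} \<Longrightarrow> a x \<ge> 0" "\<And>x. x \<in> {p<..<q} \<Longrightarrow> a x > 0"
    and G0: "\<And>y. y \<ge> 0 \<Longrightarrow> G y \<ge> 0" and G: "\<And>k. \<exists>S>0. \<forall>y\<ge>S. k * y \<le> G y"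
  shows "\<exists>M>0. \<forall>u v x. nonneg_solution a G p q u v \<longrightarrow> x \<in> {p..q} \<longrightarrow> u x \<le> M"
proof -
  define l where "l = q - p"
  have l: "l > 0" using assms by (simp add: l_def)
  define p1 where "p1 = p + l / 4"
  define q1 where "q1 = q - l / 4"
  have pq: "p < p1" "p1 < q1" "q1 < q" "p1 - p = l / 4" "q - q1 = l / 4" "q1 - p1 = l / 2"
    using l by (auto simp: p1_def q1_def l_def field_simps)
  obtain x0 where x0: "x0 \<in> {p1..q1}" "\<And>x. x \<in> {p1..q1} \<Longrightarrow> a x0 \<le> a x"
    using continuous_attains_inf[of "{p1..q1}" a] continuous_on_subset[OF a(1), of "{p1..q1}"] pq by force
  define a0 where "a0 = a x0"
  have a0: "a0 > 0" using a(3)[of x0] x0(1) pq by (auto simp: a0_def)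
  \<comment> \<open>For maximum \<open>m\<close> the slopes at \<open>p1\<close> and
    \<open>q1\<close> differ by at most \<open>8 * m / l\<close>, whereas the equation forces a drop
    of \<open>a0 * (k * (m / 4)) * (l / 2)\<close>, that is \<open>65 * m / (8 * l)\<close>. So
    \<open>65\<close> just exceeds the critical \<open>64\<close>.\<close>
  define k where "k = 65 / (a0 * l\<^sup>2)"
  have k: "k > 0" using a0 l by (simp add: k_def)
  obtain S where S: "S > 0" "\<And>y. y \<ge> S \<Longrightarrow> k * y \<le> G y" using G[of k] by blast
  have bd: "u x \<le> 4 * S"
    if sol: "nonneg_solution a G p q u v" and x: "x \<in> {p..q}" for u v x
  proof (rule ccontr)
    assume "\<not> u x \<le> 4 * S"
    have u0: "u x \<ge> 0" and du: "(u has_real_derivative v x) (at x within {p..q})"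
      and dv: "(v has_real_derivative - a x * G (u x)) (at x within {p..q})" if "x \<in> {p..q}" for x
      using sol that by (auto simp: nonneg_solution_def)
    have "continuous_on {p..q} u" by (rule DERIV_continuous_on[OF du])
    then obtain xm where xm: "xm \<in> {p..q}" "\<And>x. x \<in> {p..q} \<Longrightarrow> u x \<le> u xm"
      using continuous_attains_sup[of "{p..q}" u] assms(1) by force
    define m where "m = u xm"
    have m: "m > 4 * S" using xm(2)[OF x] \<open>\<not> u x \<le> 4 * S\<close> by (simp add: m_def)
    have m0: "m > 0" using m S by linarith
    have vdec: "v y \<le> v x" if "x \<le> y" "x \<in> {p..q}" "y \<in> {p..q}" for x y
    proof -
      have "v y - v x \<le> 0 * (y - x)"
        by (rule increment_le[OF that(1) _ dv])
          (use that a(2) G0 u0 in \<open>auto simp: mult_nonpos_nonneg\<close>)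
      then show ?thesis by simp
    qed
    have mv: "\<exists>\<xi>. s < \<xi> \<and> \<xi> < t \<and> u t - u s = v \<xi> * (t - s)" if "s < t" "p \<le> s" "t \<le> q" for s t
    proof -
      have "{s..t} \<subseteq> {p..q}" "\<And>x. x \<in> {s..t} \<Longrightarrow> (u has_real_derivative v x) (at x within {p..q})"
        using that du by auto
      from mvt_within[OF that(1) this] show ?thesis by blast
    qed
    \<comment> \<open>Concavity puts \<open>u\<close> above the chord from the maximum point to the
      endpoint beyond \<open>x\<close>. The value at that endpoint is nonnegative, its distance from
      \<open>x\<close> is at least \<open>l / 4\<close>, and the chord spans at most
      \<open>l\<close>.\<close>
    have mid: "m / 4 \<le> u x" if x: "x \<in> {p1..q1}" for x
    proof -
      consider "x = xm" | "x < xm" | "x > xm" by linarith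
      then show ?thesis
      proof cases
        case 1
        then show ?thesis using m0 by (simp add: m_def)
      next
        case 2
        have "p < x" using x pq by auto
        obtain \<xi>1 where e1: "p < \<xi>1" "\<xi>1 < x" "u x - u p = v \<xi>1 * (x - p)"
          using mv[OF \<open>p < x\<close>] x pq by auto
        obtain \<xi>2 where e2: "x < \<xi>2" "\<xi>2 < xm" "u xm - u x = v \<xi>2 * (xm - x)"
          using mv[OF 2] x pq xm(1) by auto
        have "v \<xi>2 \<le> v \<xi>1" using e1 e2 x pq xm(1) by (intro vdec) auto
        then have "v \<xi>2 * ((xm - x) * (x - p)) \<le> v \<xi>1 * ((xm - x) * (x - p))"
          using 2 \<open>p < x\<close> by (intro mult_right_mono) auto
        then have "(m - u x) * (x - p) \<le> (u x - u p) * (xm - x)"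
          unfolding m_def e1(3) e2(3) by (simp add: algebra_simps)
        also have "\<dots> \<le> u x * (xm - x)" using 2 u0[of p] assms(1) by (intro mult_right_mono) auto
        finally have "m * (x - p) \<le> u x * (xm - p)" by (simp add: algebra_simps)
        also have "\<dots> \<le> u x * l" using u0[of x] x pq xm(1) by (intro mult_left_mono) (auto simp: l_def)
        finally have "m * (x - p) \<le> u x * l" .
        moreover have "m * (l / 4) \<le> m * (x - p)" using x pq m0 by (intro mult_left_mono) auto
        ultimately have "(m / 4) * l \<le> u x * l" by simp
        then show ?thesis using l by (rule mult_right_le_imp_le)
      next
        case 3
        have "x < q" using x pq by auto
        obtain \<xi>1 where e1: "x < \<xi>1" "\<xi>1 < q" "u q - u x = v \<xi>1 * (q - x)"
          using mv[OF \<open>x < q\<close>] x pq by auto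
        obtain \<xi>2 where e2: "xm < \<xi>2" "\<xi>2 < x" "u x - u xm = v \<xi>2 * (x - xm)"
          using mv[OF 3] x pq xm(1) by auto
        have "v \<xi>1 \<le> v \<xi>2" using e1 e2 x pq xm(1) by (intro vdec) auto
        then have "v \<xi>1 * ((x - xm) * (q - x)) \<le> v \<xi>2 * ((x - xm) * (q - x))"
          using 3 \<open>x < q\<close> by (intro mult_right_mono) auto
        then have "(u q - u x) * (x - xm) \<le> (u x - m) * (q - x)"
          unfolding m_def e1(3) e2(3) by (simp add: algebra_simps)
        moreover have "- u x * (x - xm) \<le> (u q - u x) * (x - xm)"
          using 3 u0[of q] assms(1) by (intro mult_right_mono) auto
        ultimately have "m * (q - x) \<le> u x * (q - xm)" by (simp add: algebra_simps)
        also have "\<dots> \<le> u x * l" using u0[of x] x pq xm(1) by (intro mult_left_mono) (auto simp: l_def)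
        finally have "m * (q - x) \<le> u x * l" .
        moreover have "m * (l / 4) \<le> m * (q - x)" using x pq m0 by (intro mult_left_mono) auto
        ultimately have "(m / 4) * l \<le> u x * l" by simp
        then show ?thesis using l by (rule mult_right_le_imp_le)
      qed
    qed
    \<comment> \<open>Slopes decrease, so a slope above \<open>4 * m / l\<close> at
      \<open>p1\<close> would make the rise on \<open>[p,p1]\<close> exceed \<open>m\<close>; the
      bound at \<open>q1\<close> is symmetric.\<close>
    have "v p1 * (p1 - p) \<le> u p1 - u p"
      by (rule increment_ge[where S = "{p..q}" and f' = v]) (use pq du vdec in auto)
    then have 1: "v p1 * (l / 4) \<le> m"
      using xm(2)[of p1] u0[of p] pq by (auto simp: m_def)
    have "u q - u q1 \<le> v q1 * (q - q1)"
      by (rule increment_le[where S = "{p..q}" and f' = v]) (use pq du vdec in auto)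
    then have 2: "- m \<le> v q1 * (l / 4)"
      using xm(2)[of q1] u0[of q] pq by (auto simp: m_def)
    have "v q1 - v p1 \<le> - (a0 * (k * (m / 4))) * (q1 - p1)"
    proof (rule increment_le[where S = "{p..q}" and f' = "\<lambda>x. - a x * G (u x)"])
      fix x assume x: "x \<in> {p1..q1}"
      show "(v has_real_derivative - a x * G (u x)) (at x within {p..q})" using x pq by (intro dv) auto
      have "k * (m / 4) \<le> k * u x" using mid[OF x] k by (intro mult_left_mono) auto
      also have "\<dots> \<le> G (u x)" using mid[OF x] m by (intro S) auto
      finally have "a0 * (k * (m / 4)) \<le> a x * G (u x)"
        using x0(2)[OF x] a0 k m0 by (intro mult_mono) (auto simp: a0_def)
      then show "- a x * G (u x) \<le> - (a0 * (k * (m / 4)))" by simp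
    qed (use pq in auto)
    then have "(v q1 - v p1) * (l / 4) \<le> - (a0 * (k * (m / 4))) * (l / 2) * (l / 4)"
      using l pq(6) by (intro mult_right_mono) auto
    with 1 2 have "a0 * (k * (m / 4)) * (l / 2) * (l / 4) \<le> 2 * m" by (simp add: algebra_simps)
    moreover have "a0 * (k * (m / 4)) * (l / 2) * (l / 4) = 65 * m / 32"
      using a0 l by (simp add: k_def power2_eq_square field_simps)
    ultimately show False using m0 by simp
  qed
  have "4 * S > 0" using S(1) by simp
  with bd show ?thesis by blast
qed

section \<open>The shooting method\<close>

text \<open>Integrating a one-sided bound twice suffices; the term \<open>- a x * G y\<close>, which
  has no lower bound in \<open>y\<close>, may stay in the equation.\<close>

lemma ivp_solution_upper:
  assumes sol: "ivp_solution \<phi> L (p, q) u v" and le: "\<And>x y. x \<in> {0..L} \<Longrightarrow> \<phi> x y \<le> c"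
    and "c \<ge> 0" "q \<ge> 0" and x: "x \<in> {0..L}"
  shows "u x \<le> p + (q + c * L) * L"
proof -
  have u0: "u 0 = p" "v 0 = q" using sol by (auto simp: ivp_solution_def)
  have v: "v t \<le> q + c * L" if t: "t \<in> {0..L}" for t
  proof -
    have "v t - v 0 \<le> c * (t - 0)"
    proof (rule increment_le[where S = "{0..L}" and f' = "\<lambda>x. \<phi> x (u x)"])
      show "(v has_real_derivative \<phi> x (u x)) (at x within {0..L})" "\<phi> x (u x) \<le> c" if "x \<in> {0..t}" for x
        using sol le that t by (auto simp: ivp_solution_def)
    qed (use t in auto)
    moreover have "c * t \<le> c * L" using t \<open>c \<ge> 0\<close> by (intro mult_left_mono) auto
    ultimately show ?thesis using u0 by simp
  qed
  have "u x - u 0 \<le> (q + c * L) * (x - 0)"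
  proof (rule increment_le[where S = "{0..L}" and f' = v])
    show "(u has_real_derivative v t) (at t within {0..L})" "v t \<le> q + c * L" if "t \<in> {0..x}" for t
      using sol v that x by (auto simp: ivp_solution_def)
  qed (use x in auto)
  moreover have "(q + c * L) * x \<le> (q + c * L) * L"
    using x assms(3,4) by (intro mult_left_mono) auto
  ultimately show ?thesis using u0 by simp
qed

section \<open>Sign changes on either side of a level\<close>

text \<open>At the first point where \<open>w \<le> r\<close> one has \<open>w = r\<close> and hence
  \<open>f > 0\<close>; the intermediate value theorem applied to \<open>f\<close> up to that point
  stays in the region \<open>w \<ge> r\<close>.\<close>

lemma zero_before_level:
  fixes f w :: "real \<Rightarrow> real"
  assumes "p \<le> q" and f: "continuous_on {p..q} f" and w: "continuous_on {p..q} w"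
    and "f p < 0" "w p > r" "w q < r" and pos: "\<And>s. s \<in> {p..q} \<Longrightarrow> w s = r \<Longrightarrow> f s > 0"
  shows "\<exists>s\<in>{p..q}. f s = 0 \<and> w s \<ge> r"
proof -
  define S where "S = {s \<in> {p..q}. w s \<le> r}"
  have cl: "closed S"
    unfolding S_def by (intro continuous_on_closed_Collect_le w continuous_intros)
  have bb: "bdd_below S" by (rule bdd_belowI[of _ p]) (auto simp: S_def)
  have "S \<noteq> {}" using assms by (auto simp: S_def)
  then have s0: "Inf S \<in> S" using closed_contains_Inf[OF _ bb cl] by blast
  define s0 where "s0 = Inf S"
  have before: "w s > r" if "p \<le> s" "s < s0" for s
  proof (rule ccontr)
    assume "\<not> w s > r"
    then have "s \<in> S" using that s0 by (auto simp: S_def s0_def)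
    then show False using cInf_lower[OF _ bb, of s] that by (simp add: s0_def)
  qed
  have s0': "s0 \<in> {p..q}" "w s0 \<le> r" using s0 by (auto simp: S_def s0_def)
  have ws0: "w s0 = r"
  proof -
    have "continuous_on {p..s0} w" using s0' by (intro continuous_on_subset[OF w]) auto
    then obtain t where t: "p \<le> t" "t \<le> s0" "w t = r"
      using IVT2'[of w s0 r p] s0' \<open>w p > r\<close> by auto
    then show ?thesis using before[of t] by (cases "t = s0") auto
  qed
  have "continuous_on {p..s0} f" using s0' by (intro continuous_on_subset[OF f]) auto
  then obtain t where t: "p \<le> t" "t \<le> s0" "f t = 0"
    using IVT'[of f p 0 s0] s0' pos[OF s0'(1) ws0] \<open>f p < 0\<close> by auto
  then have "w t \<ge> r" using before[of t] ws0 by (cases "t = s0") auto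
  with t s0' show ?thesis by (intro bexI[of _ t]) auto
qed

text \<open>Mirror image of the preceding lemma under \<open>s\<close> to \<open>- s\<close> and
  \<open>w\<close> to \<open>- w\<close>.\<close>

lemma zero_after_level:
  fixes f w :: "real \<Rightarrow> real"
  assumes "p \<le> q" and f: "continuous_on {p..q} f" and w: "continuous_on {p..q} w"
    and "f q < 0" "w p > r" "w q < r" and pos: "\<And>s. s \<in> {p..q} \<Longrightarrow> w s = r \<Longrightarrow> f s > 0"
  shows "\<exists>s\<in>{p..q}. f s = 0 \<and> w s \<le> r"
proof -
  have "continuous_on {-q..-p} (\<lambda>s. f (- s))" "continuous_on {-q..-p} (\<lambda>s. - w (- s))"
    by (intro continuous_intros continuous_on_compose2[OF f] continuous_on_compose2[OF w]; auto)+
  then have "\<exists>s\<in>{-q..-p}. f (- s) = 0 \<and> - w (- s) \<ge> - r"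
    using assms by (intro zero_before_level) auto
  then show ?thesis by (metis atLeastAtMost_iff minus_le_iff le_minus_iff neg_le_iff_le)
qed

text \<open>\<open>G\<close> and \<open>K\<close> stand for \<open>g\<close> and the truncated \<open>k\<close>, both extended by zero to negative arguments.\<close>
locale shooting =
  fixes L \<alpha> \<beta> \<gamma> \<delta> \<tau> \<sigma> :: real and a b G K :: "real \<Rightarrow> real"
  assumes order: "0 < \<tau>" "\<tau> < \<sigma>" "\<sigma> < L"
    and coeffs: "\<alpha> \<ge> 0" "\<beta> \<ge> 0" "\<gamma> \<ge> 0" "\<delta> \<ge> 0" "\<gamma> * \<beta> + \<alpha> * \<gamma> + \<alpha> * \<delta> > 0"
    and a_cont: "continuous_on {0..L} a" and a_nonneg: "\<And>x. x \<in> {0..L} \<Longrightarrow> a x \<ge> 0"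
    and a_pos: "\<And>x. x \<in> {0<..<\<tau>} \<union> {\<sigma><..<L} \<Longrightarrow> a x > 0"
    and a_zero: "\<And>x. x \<in> {\<tau>..\<sigma>} \<Longrightarrow> a x = 0"
    and b_cont: "continuous_on {0..L} b" and b_nonneg: "\<And>x. x \<in> {0..L} \<Longrightarrow> b x \<ge> 0"
    and b_pos: "\<And>x. x \<in> {\<tau><..<\<sigma>} \<Longrightarrow> b x > 0"
    and b_zero: "\<And>x. x \<in> {0..\<tau>} \<union> {\<sigma>..L} \<Longrightarrow> b x = 0"
    and G_cont: "continuous_on UNIV G" and G_zero: "\<And>y. y \<le> 0 \<Longrightarrow> G y = 0"
    and G_pos: "\<And>y. y > 0 \<Longrightarrow> G y > 0"
    and G_small: "\<And>\<epsilon>. \<epsilon> > 0 \<Longrightarrow> \<exists>d>0. \<forall>y. 0 \<le> y \<and> y \<le> d \<longrightarrow> G y \<le> \<epsilon> * y"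
    and G_large: "\<And>m. \<exists>S>0. \<forall>y\<ge>S. m * y \<le> G y"
    and K_cont: "continuous_on UNIV K" and K_nonneg: "\<And>y. K y \<ge> 0"
    and K_lin: "\<exists>C\<ge>0. \<forall>y. K y \<le> C * max 0 y"
    and K_bounded: "\<exists>C\<ge>0. \<forall>y. K y \<le> C"
    and K_lower: "\<And>\<eta>. \<eta> > 0 \<Longrightarrow> \<exists>c>0. \<forall>y\<ge>\<eta>. c \<le> K y"
begin

definition rhs :: "real \<Rightarrow> real \<Rightarrow> real \<Rightarrow> real" where
  "rhs \<mu> x y = \<mu> * b x * K y - a x * G y"

text \<open>Every \<open>s\<close> meets the left boundary condition, so only the vanishing of
  \<open>end_value\<close> remains to be achieved.\<close>

definition shot :: "real \<Rightarrow> real \<Rightarrow> (real \<Rightarrow> real) \<Rightarrow> (real \<Rightarrow> real) \<Rightarrow> bool" where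
  "shot \<mu> s u v \<longleftrightarrow> ivp_solution (rhs \<mu>) L (\<beta> * s, \<alpha> * s) u v"

definition end_value :: "(real \<Rightarrow> real) \<Rightarrow> (real \<Rightarrow> real) \<Rightarrow> real" where
  "end_value u v = \<gamma> * u L + \<delta> * v L"

text \<open>If \<open>\<alpha> = \<beta> = 0\<close> or \<open>\<gamma> = \<delta> = 0\<close>, all
  three summands of the positive sum vanish. The number \<open>\<beta> + \<alpha> * \<tau>\<close>
  is the height at \<open>\<tau>\<close>, per unit of \<open>s\<close>, of the initial tangent of a
  shot.\<close>

lemma coeff_pos: "\<alpha> > 0 \<or> \<beta> > 0" "\<gamma> > 0 \<or> \<delta> > 0" "\<beta> + \<alpha> * \<tau> > 0"
proof -
  show *: "\<alpha> > 0 \<or> \<beta> > 0" "\<gamma> > 0 \<or> \<delta> > 0"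
    using coeffs by (cases "\<alpha> = 0"; cases "\<beta> = 0"; cases "\<gamma> = 0"; cases "\<delta> = 0"; simp)+
  show "\<beta> + \<alpha> * \<tau> > 0"
    using * coeffs order by (metis add_nonneg_pos add_pos_nonneg mult_nonneg_nonneg mult_pos_pos less_imp_le)
qed

lemma G_nonneg: "G y \<ge> 0"
  using G_zero[of y] G_pos[of y] by (cases "y \<le> 0") auto

lemma a_bound: "\<exists>A>0. \<forall>x\<in>{0..L}. a x \<le> A"
proof -
  obtain x0 where "\<forall>x\<in>{0..L}. a x \<le> a x0"
    using continuous_attains_sup[OF _ _ a_cont] order by force
  then show ?thesis by (intro exI[of _ "max 1 (a x0)"]) (auto simp: le_max_iff_disj)
qed

lemma b_bound: "\<exists>B>0. \<forall>x\<in>{0..L}. b x \<le> B"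
proof -
  obtain x0 where "\<forall>x\<in>{0..L}. b x \<le> b x0"
    using continuous_attains_sup[OF _ _ b_cont] order by force
  then show ?thesis by (intro exI[of _ "max 1 (b x0)"]) (auto simp: le_max_iff_disj)
qed

lemma b_middle: "\<exists>p q b0. \<tau> < p \<and> p < q \<and> q < \<sigma> \<and> b0 > 0 \<and> (\<forall>x\<in>{p..q}. b0 \<le> b x)"
proof -
  define p where "p = \<tau> + (\<sigma> - \<tau>) / 3"
  define q where "q = \<tau> + 2 * (\<sigma> - \<tau>) / 3"
  have pq: "\<tau> < p" "p < q" "q < \<sigma>" using order by (auto simp: p_def q_def field_simps)
  have "continuous_on {p..q} b" using pq order by (intro continuous_on_subset[OF b_cont]) auto
  then obtain x0 where x0: "x0 \<in> {p..q}" "\<forall>x\<in>{p..q}. b x0 \<le> b x"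
    using continuous_attains_inf[of "{p..q}" b] pq by auto
  then have "b x0 > 0" using pq by (intro b_pos) auto
  with x0 pq show ?thesis by blast
qed

lemma G_bound: "\<exists>C\<ge>0. \<forall>y\<le>Y. G y \<le> C"
proof -
  obtain y0 where "\<forall>y\<in>{0..max 0 Y}. G y \<le> G y0"
    using continuous_attains_sup[of "{0..max 0 Y}" G] continuous_on_subset[OF G_cont] by force
  then have "G y \<le> G y0" if "y \<le> Y" for y
    using that G_zero[of y] G_nonneg[of y0] by (cases "y \<le> 0") auto
  then show ?thesis using G_nonneg by blast
qed

text \<open>Near zero \<open>G y \<le> y\<close>; beyond \<open>d\<close> the constant bound
  \<open>C\<close> is at most \<open>C / d * y\<close>.\<close>

lemma G_lin: "\<exists>C\<ge>0. \<forall>y\<le>Y. G y \<le> C * max 0 y"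
proof -
  obtain d where d: "d > 0" "\<And>y. 0 \<le> y \<Longrightarrow> y \<le> d \<Longrightarrow> G y \<le> y"
    using G_small[of 1] by auto
  obtain C where C: "C \<ge> 0" "\<And>y. y \<le> Y \<Longrightarrow> G y \<le> C" using G_bound by blast
  have "G y \<le> (1 + C / d) * max 0 y" if "y \<le> Y" for y
  proof -
    consider "y \<le> 0" | "0 < y" "y \<le> d" | "d < y" by linarith
    then show ?thesis
    proof cases
      case 1
      then show ?thesis using G_zero by simp
    next
      case 2
      then have "G y \<le> y" using d(2) by simp
      also have "\<dots> \<le> (1 + C / d) * y" using 2 C d by (simp add: algebra_simps)
      finally show ?thesis using 2 by simp
    next
      case 3
      have "G y \<le> C / d * d" using C(2)[OF that] d by simp
      also have "\<dots> \<le> C / d * y" using 3 C d by (intro mult_left_mono) auto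
      also have "\<dots> \<le> (1 + C / d) * y" using 3 d by (simp add: algebra_simps)
      finally show ?thesis using 3 d by simp
    qed
  qed
  then show ?thesis using C d by (intro exI[of _ "1 + C / d"]) auto
qed

text \<open>Provides the growth condition under which shots continue as straight lines after a
  zero.\<close>

lemma rhs_lin:
  assumes "\<mu> \<ge> 0"
  shows "\<exists>C\<ge>0. \<forall>x\<in>{0..L}. \<forall>y\<le>Y. \<bar>rhs \<mu> x y\<bar> \<le> C * max 0 y"
proof -
  obtain A B where A: "A > 0" "\<And>x. x \<in> {0..L} \<Longrightarrow> a x \<le> A" and B: "B > 0" "\<And>x. x \<in> {0..L} \<Longrightarrow> b x \<le> B"
    using a_bound b_bound by blast
  obtain Cg Ck where g: "Cg \<ge> 0" "\<And>y. y \<le> Y \<Longrightarrow> G y \<le> Cg * max 0 y"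
    and k: "Ck \<ge> 0" "\<And>y. K y \<le> Ck * max 0 y"
    using G_lin[of Y] K_lin by blast
  have "\<bar>rhs \<mu> x y\<bar> \<le> (\<mu> * B * Ck + A * Cg) * max 0 y" if "x \<in> {0..L}" "y \<le> Y" for x y
  proof -
    have "\<mu> * b x * K y \<le> \<mu> * B * (Ck * max 0 y)"
      using that assms B b_nonneg k K_nonneg by (intro mult_mono) (auto intro: less_imp_le)
    moreover have "a x * G y \<le> A * (Cg * max 0 y)"
      using that A a_nonneg g G_nonneg by (intro mult_mono) (auto intro: less_imp_le)
    moreover have "0 \<le> \<mu> * b x * K y" "0 \<le> a x * G y"
      using that assms b_nonneg a_nonneg K_nonneg G_nonneg by auto
    ultimately show ?thesis by (simp add: rhs_def algebra_simps)
  qed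
  moreover have "\<mu> * B * Ck + A * Cg \<ge> 0" using assms A B g k by simp
  ultimately show ?thesis by blast
qed

section \<open>Elementary estimates for shots\<close>

lemma shot_deriv:
  assumes "shot \<mu> s u v" "x \<in> {0..L}"
  shows "(u has_real_derivative v x) (at x within {0..L})"
    "(v has_real_derivative rhs \<mu> x (u x)) (at x within {0..L})"
  using assms by (auto simp: shot_def ivp_solution_def)

lemma shot_init:
  assumes "shot \<mu> s u v"
  shows "u 0 = \<beta> * s" "v 0 = \<alpha> * s"
  using assms by (auto simp: shot_def ivp_solution_def)

text \<open>Past its first zero the shot is a line of negative slope. The strict inequality
  \<open>x0 < L\<close> lets this line become negative by \<open>L\<close>, which covers the case
  \<open>\<delta> = 0\<close>.\<close>

lemma shot_hits_zero:
  assumes shot: "shot \<mu> s u v" and "\<mu> \<ge> 0" "s > 0" and x0: "0 < x0" "x0 \<le> L" "u x0 \<le> 0"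
  shows "x \<in> {x0..L} \<Longrightarrow> v x < 0" "x0 < L \<Longrightarrow> end_value u v < 0"
proof -
  have lin: "\<exists>C\<ge>0. \<forall>x\<in>{0..L}. \<forall>y\<le>Y. \<bar>rhs \<mu> x y\<bar> \<le> C * max 0 y" for Y
    using rhs_lin assms(2) by blast
  have init: "0 \<le> \<beta> * s" "0 \<le> \<alpha> * s" "0 < \<beta> * s \<or> 0 < \<alpha> * s"
    using coeffs coeff_pos \<open>s > 0\<close> by auto
  obtain x1 where x1: "0 < x1" "x1 \<le> x0" "v x1 < 0" "\<And>x. x \<in> {x1..L} \<Longrightarrow> u x = v x1 * (x - x1)"
    "\<And>x. x \<in> {x1..L} \<Longrightarrow> v x = v x1"
    using ivp_solution_after_zero[OF shot[unfolded shot_def] lin init x0] by blast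
  show "v x < 0" if "x \<in> {x0..L}"
  proof -
    have "v x = v x1" using that x1(2) by (intro x1(5)) auto
    then show ?thesis using x1(3) by simp
  qed
  show "end_value u v < 0" if "x0 < L"
  proof -
    have "u L = v x1 * (L - x1)" "v L = v x1" using that x1(2) by (auto intro!: x1(4,5))
    then have "u L < 0" "v L < 0" using x1(2,3) that by (auto simp: mult_neg_pos)
    then have "\<gamma> * u L \<le> 0" "\<delta> * v L \<le> 0" "\<gamma> * u L < 0 \<or> \<delta> * v L < 0"
      using coeffs coeff_pos by (auto simp: mult_nonneg_nonpos mult_pos_neg)
    then show ?thesis by (auto simp: end_value_def)
  qed
qed

lemma shot_slope_convex:
  assumes "shot \<mu> s u v" "\<mu> \<ge> 0" "\<tau> \<le> x" "x \<le> y" "y \<le> \<sigma>"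
  shows "v x \<le> v y"
proof -
  have "0 * (y - x) \<le> v y - v x"
  proof (rule increment_ge[where S = "{0..L}" and f' = "\<lambda>x. rhs \<mu> x (u x)"])
    fix t assume "t \<in> {x..y}"
    then have t: "t \<in> {\<tau>..\<sigma>}" "t \<in> {0..L}" using assms order by auto
    show "(v has_real_derivative rhs \<mu> t (u t)) (at t within {0..L})" using shot_deriv(2)[OF assms(1) t(2)] .
    show "0 \<le> rhs \<mu> t (u t)" using a_zero[OF t(1)] b_nonneg[OF t(2)] K_nonneg assms by (simp add: rhs_def)
  qed (use assms order in auto)
  then show ?thesis by simp
qed

lemma shot_slope_concave:
  assumes "shot \<mu> s u v" "x \<le> y" "0 \<le> x \<and> y \<le> \<tau> \<or> \<sigma> \<le> x \<and> y \<le> L"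
  shows "v y \<le> v x"
proof -
  have "v y - v x \<le> 0 * (y - x)"
  proof (rule increment_le[where S = "{0..L}" and f' = "\<lambda>x. rhs \<mu> x (u x)"])
    fix t assume "t \<in> {x..y}"
    then have t: "t \<in> {0..\<tau>} \<union> {\<sigma>..L}" "t \<in> {0..L}" using assms order by auto
    show "(v has_real_derivative rhs \<mu> t (u t)) (at t within {0..L})" using shot_deriv(2)[OF assms(1) t(2)] .
    show "rhs \<mu> t (u t) \<le> 0" using b_zero[OF t(1)] a_nonneg[OF t(2)] G_nonneg by (simp add: rhs_def)
  qed (use assms order in auto)
  then show ?thesis by simp
qed

text \<open>A concave graph lies below its tangent at \<open>0\<close>.\<close>

lemma shot_left_upper:
  assumes "shot \<mu> s u v" "s \<ge> 0" "x \<in> {0..\<tau>}"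
  shows "u x \<le> (\<beta> + \<alpha> * \<tau>) * s"
proof -
  have "u x - u 0 \<le> \<alpha> * s * (x - 0)"
  proof (rule increment_le[where S = "{0..L}" and f' = v])
    fix t assume "t \<in> {0..x}"
    then have t: "0 \<le> t" "t \<le> \<tau>" "t \<in> {0..L}" using assms order by auto
    show "(u has_real_derivative v t) (at t within {0..L})" using shot_deriv(1)[OF assms(1) t(3)] .
    show "v t \<le> \<alpha> * s" using shot_slope_concave[OF assms(1), of 0 t] t shot_init[OF assms(1)] by auto
  qed (use assms order in auto)
  moreover have "\<alpha> * s * x \<le> \<alpha> * s * \<tau>" using assms coeffs by (intro mult_left_mono) auto
  ultimately show ?thesis using shot_init[OF assms(1)] by (simp add: algebra_simps)
qed

text \<open>The term with \<open>b\<close> only pushes upwards, so these bounds do not involve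
  \<open>\<mu>\<close>.\<close>

lemma shot_lower:
  assumes "shot \<mu> s u v" "\<mu> \<ge> 0" and c: "c \<ge> 0" "\<And>t. t \<in> {0..X} \<Longrightarrow> a t * G (u t) \<le> c"
    and X: "X \<le> L" and x: "x \<in> {0..X}"
  shows "\<alpha> * s - c * L \<le> v x" "\<beta> * s + \<alpha> * s * x - c * L * x \<le> u x"
proof -
  have v: "\<alpha> * s - c * L \<le> v x" if "x \<in> {0..X}" for x
  proof -
    have "- c * (x - 0) \<le> v x - v 0"
    proof (rule increment_ge[where S = "{0..L}" and f' = "\<lambda>x. rhs \<mu> x (u x)"])
      fix t assume "t \<in> {0..x}"
      then have t: "t \<in> {0..X}" "t \<in> {0..L}" using that X by auto
      show "(v has_real_derivative rhs \<mu> t (u t)) (at t within {0..L})" using shot_deriv(2)[OF assms(1) t(2)] .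
      have "0 \<le> \<mu> * b t * K (u t)" using b_nonneg[OF t(2)] K_nonneg assms by simp
      then show "- c \<le> rhs \<mu> t (u t)" using c(2)[OF t(1)] by (simp add: rhs_def)
    qed (use that X in auto)
    moreover have "c * x \<le> c * L" using that X c by (intro mult_left_mono) auto
    ultimately show ?thesis using shot_init[OF assms(1)] by simp
  qed
  show "\<alpha> * s - c * L \<le> v x" using v x .
  have "(\<alpha> * s - c * L) * (x - 0) \<le> u x - u 0"
  proof (rule increment_ge[where S = "{0..L}" and f' = v])
    fix t assume "t \<in> {0..x}"
    then have t: "t \<in> {0..X}" "t \<in> {0..L}" using x X by auto
    show "(u has_real_derivative v t) (at t within {0..L})" using shot_deriv(1)[OF assms(1) t(2)] .
    show "\<alpha> * s - c * L \<le> v t" using v[OF t(1)] .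
  qed (use x X in auto)
  then show "\<beta> * s + \<alpha> * s * x - c * L * x \<le> u x"
    using shot_init[OF assms(1)] by (simp add: algebra_simps)
qed

text \<open>On \<open>[0,\<tau>]\<close> the term with \<open>a\<close> is controlled through the
  tangent bound; on \<open>[\<tau>,\<sigma>]\<close>, where a large \<open>\<mu>\<close> may drive
  \<open>u\<close> very high, \<open>a\<close> is zero.\<close>

lemma shot_left_lower:
  assumes "shot \<mu> s u v" "\<mu> \<ge> 0" "s \<ge> 0" and c: "c \<ge> 0" "\<And>x y. x \<in> {0..L} \<Longrightarrow> y \<le> (\<beta> + \<alpha> * \<tau>) * s \<Longrightarrow> a x * G y \<le> c"
    and x: "x \<in> {0..\<sigma>}"
  shows "\<alpha> * s - c * L \<le> v x" "\<beta> * s + \<alpha> * s * x - c * L * x \<le> u x"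
proof -
  have *: "a t * G (u t) \<le> c" if "t \<in> {0..\<sigma>}" for t
  proof (cases "t \<le> \<tau>")
    case True
    then show ?thesis using that c(2) shot_left_upper[OF assms(1,3)] order by auto
  next
    case False
    then show ?thesis using that a_zero[of t] c by auto
  qed
  show "\<alpha> * s - c * L \<le> v x" "\<beta> * s + \<alpha> * s * x - c * L * x \<le> u x"
    using shot_lower[OF assms(1,2) c(1) * _ x] order by auto
qed

section \<open>Signs of \<open>end_value\<close> at the selected parameters\<close>

text \<open>A shot positive on \<open>]0,\<tau>]\<close> is bounded by a constant \<open>M\<close>
  free of \<open>s\<close> and \<open>\<mu>\<close>. Its concavity is then bounded too, so for large
  \<open>s\<close> it stays close enough to its initial tangent to exceed \<open>M\<close> at
  \<open>\<tau>\<close>, a contradiction.\<close>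

lemma large_shot:
  "\<exists>s2>0. \<forall>\<mu>\<ge>0. \<forall>u v. shot \<mu> s2 u v \<longrightarrow> end_value u v < 0 \<and> v \<sigma> < 0"
proof -
  obtain A where A: "A > 0" "\<And>x. x \<in> {0..L} \<Longrightarrow> a x \<le> A" using a_bound by blast
  have "continuous_on {0..\<tau>} a" by (rule continuous_on_subset[OF a_cont]) (use order in auto)
  then have "\<exists>M>0. \<forall>u v x. nonneg_solution a G 0 \<tau> u v \<longrightarrow> x \<in> {0..\<tau>} \<longrightarrow> u x \<le> M"
    by (rule nonneg_solution_bound[rotated]) (use order a_nonneg a_pos G_nonneg G_large in auto)
  then obtain M where M: "M > 0" "\<And>u v x. nonneg_solution a G 0 \<tau> u v \<Longrightarrow> x \<in> {0..\<tau>} \<Longrightarrow> u x \<le> M"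
    by blast
  obtain \<Gamma> where \<Gamma>: "\<Gamma> \<ge> 0" "\<And>y. y \<le> M \<Longrightarrow> G y \<le> \<Gamma>" using G_bound by blast
  define \<kappa> where "\<kappa> = \<beta> + \<alpha> * \<tau>"
  have \<kappa>: "\<kappa> > 0" using coeff_pos by (simp add: \<kappa>_def)
  \<comment> \<open>As long as \<open>u \<le> M\<close>, the loss against the tangent height
    \<open>\<kappa> * s2\<close> is at most \<open>A * \<Gamma> * L * \<tau>\<close>; this choice
    leaves \<open>M + 1\<close>.\<close>
  define s2 where "s2 = (M + 1 + A * \<Gamma> * L * \<tau>) / \<kappa>"
  have "A * \<Gamma> * L * \<tau> \<ge> 0" using A \<Gamma> order by simp
  then have s2: "s2 > 0" "\<kappa> * s2 = M + 1 + A * \<Gamma> * L * \<tau>"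
    using \<kappa> M by (auto simp: s2_def intro!: divide_pos_pos)
  have "end_value u v < 0 \<and> v \<sigma> < 0" if shot: "shot \<mu> s2 u v" and "\<mu> \<ge> 0" for \<mu> u v
  proof -
    have "\<exists>x0. 0 < x0 \<and> x0 \<le> \<tau> \<and> u x0 \<le> 0"
    proof (rule ccontr)
      assume "\<not> ?thesis"
      then have pos: "u x > 0" if "0 < x" "x \<le> \<tau>" for x using that by force
      have "nonneg_solution a G 0 \<tau> u v"
        unfolding nonneg_solution_def
      proof
        fix x assume x: "x \<in> {0..\<tau>}"
        have "u x \<ge> 0"
        proof (cases "x = 0")
          case True
          then show ?thesis using shot_init[OF shot] coeffs s2 by simp
        next
          case False
          then show ?thesis using pos[of x] x by simp
        qed
        moreover have "(u has_real_derivative v x) (at x within {0..\<tau>})"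
          "(v has_real_derivative rhs \<mu> x (u x)) (at x within {0..\<tau>})"
          using ivp_solution_subinterval[OF shot[unfolded shot_def], of 0 \<tau> x] x order by auto
        moreover have "rhs \<mu> x (u x) = - a x * G (u x)" using b_zero[of x] x by (simp add: rhs_def)
        ultimately show "u x \<ge> 0 \<and> (u has_real_derivative v x) (at x within {0..\<tau>}) \<and>
           (v has_real_derivative - a x * G (u x)) (at x within {0..\<tau>})" by simp
      qed
      then have le: "u x \<le> M" if "x \<in> {0..\<tau>}" for x using M(2) that by blast
      have "a t * G (u t) \<le> A * \<Gamma>" if "t \<in> {0..\<tau>}" for t
        using that A a_nonneg \<Gamma> le G_nonneg order by (intro mult_mono) auto
      from shot_lower(2)[OF shot \<open>\<mu> \<ge> 0\<close> _ this, of \<tau>]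
      have "\<beta> * s2 + \<alpha> * s2 * \<tau> - A * \<Gamma> * L * \<tau> \<le> u \<tau>" using A \<Gamma> order by simp
      then have "\<kappa> * s2 - A * \<Gamma> * L * \<tau> \<le> u \<tau>" by (simp add: \<kappa>_def algebra_simps)
      then show False using s2(2) le[of \<tau>] order by auto
    qed
    then obtain x0 where x0: "0 < x0" "x0 \<le> \<tau>" "u x0 \<le> 0" by blast
    show ?thesis
      using shot_hits_zero[OF shot \<open>\<mu> \<ge> 0\<close> s2(1) x0(1) _ x0(3)] x0 order by auto
  qed
  with s2(1) show ?thesis by blast
qed

text \<open>Wherever \<open>u \<ge> \<eta>\<close>, the factor \<open>K (u x)\<close> is bounded
  below, and so is \<open>b\<close> on a compact part of \<open>]\<tau>,\<sigma>[\<close>. The gain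
  of slope therefore grows linearly in \<open>\<mu>\<close>, uniformly over all shots.\<close>

lemma shot_kick:
  assumes "\<eta> > 0"
  shows "\<exists>p q h. \<tau> < p \<and> p < q \<and> q < \<sigma> \<and> h > 0 \<and>
    (\<forall>\<mu>\<ge>0. \<forall>s u v. shot \<mu> s u v \<longrightarrow> (\<forall>x\<in>{\<tau>..\<sigma>}. u x \<ge> \<eta>) \<longrightarrow> \<mu> * h \<le> v q - v p)"
proof -
  obtain p q b0 where pq: "\<tau> < p" "p < q" "q < \<sigma>" "b0 > 0" "\<And>x. x \<in> {p..q} \<Longrightarrow> b0 \<le> b x"
    using b_middle by blast
  obtain c where c: "c > 0" "\<And>y. y \<ge> \<eta> \<Longrightarrow> c \<le> K y" using K_lower[OF assms] by blast
  have "\<mu> * (b0 * c * (q - p)) \<le> v q - v p"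
    if "\<mu> \<ge> 0" and shot: "shot \<mu> s u v" and ge: "\<forall>x\<in>{\<tau>..\<sigma>}. u x \<ge> \<eta>" for \<mu> s u v
  proof -
    have "\<mu> * (b0 * c) * (q - p) \<le> v q - v p"
    proof (rule increment_ge[where S = "{0..L}" and f' = "\<lambda>x. rhs \<mu> x (u x)"])
      fix t assume "t \<in> {p..q}"
      then have t: "t \<in> {p..q}" "t \<in> {0..L}" "t \<in> {\<tau>..\<sigma>}" using pq order by auto
      show "(v has_real_derivative rhs \<mu> t (u t)) (at t within {0..L})" using shot_deriv(2)[OF shot t(2)] .
      have "\<mu> * (b0 * c) \<le> \<mu> * (b t * K (u t))"
        using pq c ge t \<open>\<mu> \<ge> 0\<close> b_nonneg[OF t(2)] by (intro mult_left_mono mult_mono) auto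
      then show "\<mu> * (b0 * c) \<le> rhs \<mu> t (u t)" using a_zero[OF t(3)] by (simp add: rhs_def)
    qed (use pq order in auto)
    then show ?thesis by (simp add: mult.assoc)
  qed
  moreover have "b0 * c * (q - p) > 0" using pq c by simp
  ultimately show ?thesis using pq by blast
qed

text \<open>The parameter \<open>s1\<close> is fixed before \<open>\<mu>\<close>, so small that the
  shot keeps half of its tangent height up to \<open>\<sigma>\<close>. The kick then makes
  \<open>u \<sigma>\<close> larger than any nonnegative solution on \<open>[\<sigma>,L']\<close>
  permits. Only the threshold for \<open>\<mu>\<close> depends on \<open>r\<close>.\<close>

lemma medium_shot:
  assumes "s2 > 0"
  shows "\<exists>s1>0. s1 < s2 \<and> (\<forall>r. \<exists>\<mu>0\<ge>0. \<forall>\<mu>\<ge>\<mu>0. \<forall>u v. shot \<mu> s1 u v \<longrightarrow> end_value u v < 0 \<and> v \<sigma> > r)"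
proof -
  obtain A where A: "A > 0" "\<And>x. x \<in> {0..L} \<Longrightarrow> a x \<le> A" using a_bound by blast
  define \<kappa> where "\<kappa> = \<beta> + \<alpha> * \<tau>"
  have \<kappa>: "\<kappa> > 0" using coeff_pos by (simp add: \<kappa>_def)
  \<comment> \<open>Makes the total loss \<open>c * L * L\<close> exactly half of
    \<open>\<kappa> * s1\<close>.\<close>
  define \<epsilon> where "\<epsilon> = 1 / (2 * A * L\<^sup>2)"
  have L: "L > 0" using order by simp
  have \<epsilon>: "\<epsilon> > 0" using A L by (simp add: \<epsilon>_def)
  obtain d where d: "d > 0" "\<And>y. 0 \<le> y \<Longrightarrow> y \<le> d \<Longrightarrow> G y \<le> \<epsilon> * y" using G_small[OF \<epsilon>] by blast
  define s1 where "s1 = min (s2 / 2) (d / \<kappa>)"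
  have "s1 \<le> d / \<kappa>" by (simp add: s1_def)
  then have "\<kappa> * s1 \<le> d" using \<kappa> by (simp add: pos_le_divide_eq mult.commute)
  moreover have "s1 > 0" "s1 < s2" using assms d \<kappa> by (auto simp: s1_def min_less_iff_disj)
  ultimately have s1: "s1 > 0" "s1 < s2" "\<kappa> * s1 \<le> d" by auto
  define c where "c = A * (\<epsilon> * (\<kappa> * s1))"
  have c: "c > 0" using A \<epsilon> \<kappa> s1 by (simp add: c_def)
  have cL: "c * L * L = \<kappa> * s1 / 2" using A L by (simp add: c_def \<epsilon>_def power2_eq_square)
  have ac: "a x * G y \<le> c" if "x \<in> {0..L}" "y \<le> (\<beta> + \<alpha> * \<tau>) * s1" for x y
  proof -
    have "G y \<le> \<epsilon> * (\<kappa> * s1)"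
    proof (cases "y \<le> 0")
      case True
      then show ?thesis using G_zero \<epsilon> \<kappa> s1 by simp
    next
      case False
      then have "G y \<le> \<epsilon> * y" using that s1 by (intro d) (auto simp: \<kappa>_def)
      also have "\<dots> \<le> \<epsilon> * (\<kappa> * s1)" using that \<epsilon> by (intro mult_left_mono) (auto simp: \<kappa>_def)
      finally show ?thesis .
    qed
    then show ?thesis unfolding c_def using that A a_nonneg G_nonneg by (intro mult_mono) auto
  qed
  define \<eta> where "\<eta> = \<kappa> * s1 / 2"
  have \<eta>: "\<eta> > 0" using \<kappa> s1 by (simp add: \<eta>_def)
  obtain p q h where pq: "\<tau> < p" "p < q" "q < \<sigma>" "h > 0"
    and kick: "\<forall>\<mu>\<ge>0. \<forall>s u v. shot \<mu> s u v \<longrightarrow> (\<forall>x\<in>{\<tau>..\<sigma>}. u x \<ge> \<eta>) \<longrightarrow> \<mu> * h \<le> v q - v p"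
    using shot_kick[OF \<eta>] by blast
  \<comment> \<open>Stopping before \<open>L\<close> makes the zero of \<open>u\<close> lie strictly
    before \<open>L\<close>, as a strictly negative end value requires.\<close>
  define L' where "L' = (\<sigma> + L) / 2"
  have L': "\<sigma> < L'" "L' < L" using order by (auto simp: L'_def)
  have "continuous_on {\<sigma>..L'} a" by (rule continuous_on_subset[OF a_cont]) (use order L' in auto)
  then have "\<exists>M>0. \<forall>u v x. nonneg_solution a G \<sigma> L' u v \<longrightarrow> x \<in> {\<sigma>..L'} \<longrightarrow> u x \<le> M"
    by (rule nonneg_solution_bound[rotated]) (use order L' a_nonneg a_pos G_nonneg G_large in auto)
  then obtain M where M: "M > 0" "\<And>u v x. nonneg_solution a G \<sigma> L' u v \<Longrightarrow> x \<in> {\<sigma>..L'} \<Longrightarrow> u x \<le> M"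
    by blast
  have "\<exists>\<mu>0\<ge>0. \<forall>\<mu>\<ge>\<mu>0. \<forall>u v. shot \<mu> s1 u v \<longrightarrow> end_value u v < 0 \<and> v \<sigma> > r" for r
  proof -
    \<comment> \<open>A slope \<open>W\<close> exceeds \<open>r\<close> and raises \<open>u\<close>
      by at least \<open>M + 1\<close> over \<open>[q,\<sigma>]\<close>. The threshold
      \<open>\<mu>0\<close> below also compensates a slope at \<open>p\<close> as low as
      \<open>- c * L\<close>.\<close>
    define W where "W = max (r + 1) ((M + 1) / (\<sigma> - q))"
    have "(M + 1) / (\<sigma> - q) > 0" using M pq by simp
    then have W: "W > r" "W > 0" "W * (\<sigma> - q) \<ge> M + 1"
      using pq by (auto simp: W_def less_max_iff_disj pos_divide_le_eq[symmetric])
    define \<mu>0 where "\<mu>0 = (W + c * L) / h"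
    have \<mu>0: "\<mu>0 \<ge> 0" using W c L pq by (simp add: \<mu>0_def)
    have "end_value u v < 0 \<and> v \<sigma> > r" if "\<mu> \<ge> \<mu>0" and shot: "shot \<mu> s1 u v" for \<mu> u v
    proof -
      have \<mu>: "\<mu> \<ge> 0" using that \<mu>0 by simp
      note low = shot_left_lower[OF shot \<mu> less_imp_le[OF s1(1)] less_imp_le[OF c] ac]
      have ge: "u x \<ge> \<eta>" if x: "x \<in> {\<tau>..\<sigma>}" for x
      proof -
        have "c * L * x \<le> c * L * L" using x order c L by (intro mult_left_mono) auto
        moreover have "\<alpha> * s1 * \<tau> \<le> \<alpha> * s1 * x" using x coeffs s1 by (intro mult_left_mono) auto
        moreover have "\<kappa> * s1 = \<beta> * s1 + \<alpha> * s1 * \<tau>" by (simp add: \<kappa>_def algebra_simps)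
        ultimately show ?thesis using low(2)[of x] x order cL by (simp add: \<eta>_def)
      qed
      have "W + c * L \<le> \<mu> * h" using that(1) pq by (simp add: \<mu>0_def pos_divide_le_eq)
      moreover have "\<mu> * h \<le> v q - v p" using kick[rule_format, OF \<mu> shot ge] .
      moreover have "\<alpha> * s1 \<ge> 0" using coeffs s1 by simp
      moreover have "\<alpha> * s1 - c * L \<le> v p" using low(1)[of p] pq order by simp
      ultimately have vq: "W \<le> v q" by linarith
      have vW: "W \<le> v x" if "x \<in> {q..\<sigma>}" for x
        using shot_slope_convex[OF shot \<mu>, of q x] vq that pq by auto
      have "W * (\<sigma> - q) \<le> u \<sigma> - u q"
        by (rule increment_ge[where S = "{0..L}" and f' = v])
          (use pq order vW shot_deriv(1)[OF shot] in auto)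
      then have u\<sigma>: "u \<sigma> > M" using W(3) ge[of q] \<eta> pq by auto
      have "\<exists>x0. \<sigma> \<le> x0 \<and> x0 \<le> L' \<and> u x0 \<le> 0"
      proof (rule ccontr)
        assume "\<not> ?thesis"
        then have pos: "u x > 0" if "\<sigma> \<le> x" "x \<le> L'" for x using that by force
        have "nonneg_solution a G \<sigma> L' u v"
          unfolding nonneg_solution_def
        proof
          fix x assume x: "x \<in> {\<sigma>..L'}"
          have "(u has_real_derivative v x) (at x within {\<sigma>..L'})"
            "(v has_real_derivative rhs \<mu> x (u x)) (at x within {\<sigma>..L'})"
            using ivp_solution_subinterval[OF shot[unfolded shot_def], of \<sigma> L' x] x order L' by auto
          moreover have "rhs \<mu> x (u x) = - a x * G (u x)" using b_zero[of x] x L' by (simp add: rhs_def)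
          ultimately show "u x \<ge> 0 \<and> (u has_real_derivative v x) (at x within {\<sigma>..L'}) \<and>
             (v has_real_derivative - a x * G (u x)) (at x within {\<sigma>..L'})"
            using pos[of x] x by simp
        qed
        then show False using M(2)[of u v \<sigma>] u\<sigma> L' by auto
      qed
      then obtain x0 where "\<sigma> \<le> x0" "x0 \<le> L'" "u x0 \<le> 0" by blast
      then have "end_value u v < 0"
        using shot_hits_zero(2)[OF shot \<mu> s1(1), of x0] L' order by auto
      then show ?thesis using vW[of \<sigma>] W(1) pq by auto
    qed
    with \<mu>0 show ?thesis by blast
  qed
  with s1 show ?thesis by blast
qed

text \<open>A slope as small as \<open>r\<close> at \<open>\<sigma>\<close> rules out a strong kick,
  so for large \<open>\<mu>\<close> the value \<open>u \<sigma>\<close> is below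
  \<open>2 * \<eta>\<close>. Then \<open>u\<close> remains on \<open>[\<sigma>,L]\<close> in the
  range where \<open>G\<close> is almost flat, and at least half of the slope survives.\<close>

lemma grazing_shot:
  assumes "s2 > 0"
  shows "\<exists>r>0. \<exists>\<mu>0\<ge>0. \<forall>\<mu>\<ge>\<mu>0. \<forall>s u v. 0 < s \<longrightarrow> s \<le> s2 \<longrightarrow> shot \<mu> s u v \<longrightarrow> v \<sigma> = r \<longrightarrow> end_value u v > 0"
proof -
  obtain A where A: "A > 0" "\<And>x. x \<in> {0..L} \<Longrightarrow> a x \<le> A" using a_bound by blast
  have L: "L > 0" using order by simp
  \<comment> \<open>With \<open>3 * r * L = d\<close> as the bound for \<open>u\<close>, the
    curvature is at most \<open>r / (2 * L)\<close>, so over a length \<open>L\<close> the slope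
    loses at most \<open>r / 2\<close>.\<close>
  define \<epsilon> where "\<epsilon> = 1 / (6 * A * L\<^sup>2)"
  have \<epsilon>: "\<epsilon> > 0" using A L by (simp add: \<epsilon>_def)
  obtain d where d: "d > 0" "\<And>y. 0 \<le> y \<Longrightarrow> y \<le> d \<Longrightarrow> G y \<le> \<epsilon> * y" using G_small[OF \<epsilon>] by blast
  define r where "r = d / (3 * L)"
  have r: "r > 0" "3 * r * L = d" using d L by (auto simp: r_def)
  define \<eta> where "\<eta> = r * (\<sigma> - \<tau>)"
  have \<eta>: "\<eta> > 0" using r order by (simp add: \<eta>_def)
  obtain p q h where pq: "\<tau> < p" "p < q" "q < \<sigma>" "h > 0"
    and kick: "\<forall>\<mu>\<ge>0. \<forall>s u v. shot \<mu> s u v \<longrightarrow> (\<forall>x\<in>{\<tau>..\<sigma>}. u x \<ge> \<eta>) \<longrightarrow> \<mu> * h \<le> v q - v p"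
    using shot_kick[OF \<eta>] by blast
  define \<kappa> where "\<kappa> = \<beta> + \<alpha> * \<tau>"
  have \<kappa>: "\<kappa> > 0" using coeff_pos by (simp add: \<kappa>_def)
  obtain \<Gamma> where \<Gamma>: "\<Gamma> \<ge> 0" "\<And>y. y \<le> \<kappa> * s2 \<Longrightarrow> G y \<le> \<Gamma>" using G_bound by blast
  define c where "c = A * \<Gamma>"
  have c: "c \<ge> 0" using A \<Gamma> by (simp add: c_def)
  \<comment> \<open>The slope is at least \<open>- c * L\<close> at \<open>p\<close> and at most
    \<open>r\<close> at \<open>q\<close>; beyond this threshold the kick would exceed the
    difference.\<close>
  define \<mu>0 where "\<mu>0 = (r + c * L + 1) / h"
  have \<mu>0: "\<mu>0 \<ge> 0" using r c L pq by (simp add: \<mu>0_def)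
  have "end_value u v > 0"
    if "\<mu> \<ge> \<mu>0" and s: "0 < s" "s \<le> s2" and shot: "shot \<mu> s u v" and v\<sigma>: "v \<sigma> = r" for \<mu> s u v
  proof -
    have \<mu>: "\<mu> \<ge> 0" using that \<mu>0 by simp
    have ac: "a x * G y \<le> c" if "x \<in> {0..L}" "y \<le> (\<beta> + \<alpha> * \<tau>) * s" for x y
    proof -
      have "\<kappa> * s \<le> \<kappa> * s2" using \<kappa> s by (intro mult_left_mono) auto
      then show ?thesis unfolding c_def
        using that A a_nonneg G_nonneg by (intro mult_mono \<Gamma>) (auto simp: \<kappa>_def)
    qed
    note low = shot_left_lower[OF shot \<mu> less_imp_le[OF s(1)] c ac]
    \<comment> \<open>A nonpositive value at \<open>\<sigma>\<close> would force a negative slope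
      there.\<close>
    have u\<sigma>: "u \<sigma> > 0"
      using shot_hits_zero(1)[OF shot \<mu> s(1), of \<sigma> \<sigma>] v\<sigma> r order by force
    have u\<sigma>': "u \<sigma> < 2 * \<eta>"
    proof (rule ccontr)
      assume "\<not> u \<sigma> < 2 * \<eta>"
      \<comment> \<open>By convexity the slope is at most \<open>r\<close> before
        \<open>\<sigma>\<close>, so going back from \<open>\<sigma>\<close> the function can fall by
        at most \<open>r * (\<sigma> - \<tau>) = \<eta>\<close>.\<close>
      have "u x \<ge> \<eta>" if x: "x \<in> {\<tau>..\<sigma>}" for x
      proof -
        have "u \<sigma> - u x \<le> r * (\<sigma> - x)"
        proof (rule increment_le[where S = "{0..L}" and f' = v])
          show "v t \<le> r" if "t \<in> {x..\<sigma>}" for t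
            using shot_slope_convex[OF shot \<mu>, of t \<sigma>] v\<sigma> that x by auto
        qed (use x order shot_deriv(1)[OF shot] in auto)
        moreover have "r * (\<sigma> - x) \<le> \<eta>" unfolding \<eta>_def using x r by (intro mult_left_mono) auto
        ultimately show ?thesis using \<open>\<not> u \<sigma> < 2 * \<eta>\<close> by linarith
      qed
      then have "\<mu> * h \<le> v q - v p" using kick \<mu> shot by blast
      moreover have "v q \<le> r" using shot_slope_convex[OF shot \<mu>, of q \<sigma>] v\<sigma> pq by auto
      moreover have "\<alpha> * s - c * L \<le> v p" using low(1)[of p] pq order by simp
      moreover have "\<alpha> * s \<ge> 0" using coeffs s by simp
      moreover have "r + c * L + 1 \<le> \<mu> * h" using that(1) pq by (simp add: \<mu>0_def pos_divide_le_eq)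
      ultimately show False by linarith
    qed
    have ule: "u x \<le> 3 * r * L" if x: "x \<in> {\<sigma>..L}" for x
    proof -
      have "u x - u \<sigma> \<le> r * (x - \<sigma>)"
      proof (rule increment_le[where S = "{0..L}" and f' = v])
        show "v t \<le> r" if "t \<in> {\<sigma>..x}" for t
          using shot_slope_concave[OF shot, of \<sigma> t] v\<sigma> that x by auto
      qed (use x order shot_deriv(1)[OF shot] in auto)
      moreover have "2 * (r * (\<sigma> - \<tau>)) + r * (x - \<sigma>) \<le> 3 * r * L"
      proof -
        have "r * (2 * (\<sigma> - \<tau>) + (x - \<sigma>)) \<le> r * (3 * L)"
          using r x order by (intro mult_left_mono) auto
        then show ?thesis by (simp add: algebra_simps)
      qed
      ultimately show ?thesis using u\<sigma>' by (simp add: \<eta>_def)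
    qed
    have vge: "r / 2 \<le> v x" if x: "x \<in> {\<sigma>..L}" for x
    proof -
      have "- (r / (2 * L)) * (x - \<sigma>) \<le> v x - v \<sigma>"
      proof (rule increment_ge[where S = "{0..L}" and f' = "\<lambda>x. rhs \<mu> x (u x)"])
        fix t assume "t \<in> {\<sigma>..x}"
        then have t: "t \<in> {\<sigma>..L}" "t \<in> {0..L}" using x order by auto
        show "(v has_real_derivative rhs \<mu> t (u t)) (at t within {0..L})" using shot_deriv(2)[OF shot t(2)] .
        have "G (u t) \<le> \<epsilon> * (3 * r * L)"
        proof (cases "u t \<le> 0")
          case True
          then show ?thesis using G_zero \<epsilon> r(2) d by simp
        next
          case False
          then have "G (u t) \<le> \<epsilon> * u t" using ule[OF t(1)] r by (intro d) auto
          also have "\<dots> \<le> \<epsilon> * (3 * r * L)" using ule[OF t(1)] \<epsilon> by (intro mult_left_mono) auto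
          finally show ?thesis .
        qed
        then have "a t * G (u t) \<le> A * (\<epsilon> * (3 * r * L))"
          using A a_nonneg t G_nonneg by (intro mult_mono) auto
        also have "\<dots> = r / (2 * L)" using A L by (simp add: \<epsilon>_def field_simps power2_eq_square)
        finally show "- (r / (2 * L)) \<le> rhs \<mu> t (u t)" using b_zero[of t] t by (simp add: rhs_def)
      qed (use x order in auto)
      moreover have "(r / (2 * L)) * (x - \<sigma>) \<le> (r / (2 * L)) * L"
        using x order r L by (intro mult_left_mono) auto
      moreover have "(r / (2 * L)) * L = r / 2" using L by simp
      ultimately show ?thesis using v\<sigma> by linarith
    qed
    have "0 * (L - \<sigma>) \<le> u L - u \<sigma>"
    proof (rule increment_ge[where S = "{0..L}" and f' = v])
      show "0 \<le> v t" if "t \<in> {\<sigma>..L}" for t using vge[OF that] r by linarith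
    qed (use order shot_deriv(1)[OF shot] in auto)
    then have "u L > 0" "v L > 0" using u\<sigma> vge[of L] r order by auto
    then have "\<gamma> * u L \<ge> 0" "\<delta> * v L \<ge> 0" "\<gamma> * u L > 0 \<or> \<delta> * v L > 0"
      using coeffs coeff_pos by auto
    then show ?thesis by (auto simp: end_value_def)
  qed
  with r(1) \<mu>0 show ?thesis by blast
qed

text \<open>Stated for every \<open>\<phi>\<close> dominated by values of \<open>rhs\<close>, so
  that it also covers the clipped equation before its solutions are known to be shots. It rests on
  \<open>K\<close> being bounded; \<open>U\<close> may depend on \<open>\<mu>\<close>.\<close>

lemma shot_upper:
  assumes "\<mu> \<ge> 0"
  shows "\<exists>U>0. \<forall>\<phi> s u v x. 0 \<le> s \<longrightarrow> s \<le> s2 \<longrightarrow>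
    (\<forall>x\<in>{0..L}. \<forall>y. \<exists>y'. \<phi> x y \<le> rhs \<mu> x y') \<longrightarrow> ivp_solution \<phi> L (\<beta> * s, \<alpha> * s) u v \<longrightarrow> x \<in> {0..L} \<longrightarrow> u x \<le> U"
proof -
  obtain B where B: "B > 0" "\<And>x. x \<in> {0..L} \<Longrightarrow> b x \<le> B" using b_bound by blast
  obtain C where C: "C \<ge> 0" "\<And>y. K y \<le> C" using K_bounded by blast
  define c where "c = \<mu> * B * C"
  have c: "c \<ge> 0" using assms B C by (simp add: c_def)
  have rle: "rhs \<mu> x y \<le> c" if "x \<in> {0..L}" for x y
  proof -
    have "\<mu> * b x * K y \<le> \<mu> * B * C"
      using that assms B C K_nonneg b_nonneg by (intro mult_mono mult_nonneg_nonneg) (auto intro: less_imp_le)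
    moreover have "a x * G y \<ge> 0" using that a_nonneg G_nonneg by simp
    ultimately show ?thesis by (simp add: rhs_def c_def)
  qed
  define U where "U = max 1 (\<beta> * s2 + (\<alpha> * s2 + c * L) * L)"
  have "u x \<le> U"
    if s: "0 \<le> s" "s \<le> s2" and le: "\<forall>x\<in>{0..L}. \<forall>y. \<exists>y'. \<phi> x y \<le> rhs \<mu> x y'"
      and sol: "ivp_solution \<phi> L (\<beta> * s, \<alpha> * s) u v" and x: "x \<in> {0..L}" for \<phi> s u v x
  proof -
    have "\<phi> x y \<le> c" if "x \<in> {0..L}" for x y
      using le rle[OF that] that by (meson order_trans)
    then have "u x \<le> \<beta> * s + (\<alpha> * s + c * L) * L"
      using c s coeffs x by (intro ivp_solution_upper[OF sol]) auto
    also have "\<dots> \<le> \<beta> * s2 + (\<alpha> * s2 + c * L) * L"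
      using s coeffs order by (intro add_mono mult_right_mono mult_left_mono) auto
    finally show ?thesis by (simp add: U_def)
  qed
  moreover have "U > 0" by (simp add: U_def)
  ultimately show ?thesis by blast
qed

text \<open>The energy bound gives \<open>u \<le> \<Lambda> * s\<close>, with
  \<open>\<Lambda>\<close> depending on \<open>\<mu>\<close>. As \<open>G\<close> is of smaller
  order than linear at zero, the end value is at least that of the initial tangent up to a
  negligible loss.\<close>

lemma small_shot:
  assumes "s1 > 0" "\<mu> \<ge> 0"
  shows "\<exists>s0>0. s0 < s1 \<and> (\<forall>u v. shot \<mu> s0 u v \<longrightarrow> end_value u v > 0)"
proof -
  obtain A where A: "A > 0" "\<And>x. x \<in> {0..L} \<Longrightarrow> a x \<le> A" using a_bound by blast
  have L: "L > 0" using order by simp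
  obtain U where U: "\<And>s u v x. 0 \<le> s \<Longrightarrow> s \<le> s1 \<Longrightarrow> shot \<mu> s u v \<Longrightarrow> x \<in> {0..L} \<Longrightarrow> u x \<le> U"
    using shot_upper[OF assms(2), of s1] unfolding shot_def by (metis order_refl)
  obtain C where C: "C \<ge> 0" "\<And>x y. x \<in> {0..L} \<Longrightarrow> y \<le> U \<Longrightarrow> \<bar>rhs \<mu> x y\<bar> \<le> C * max 0 y"
    using rhs_lin[OF assms(2)] by blast
  define \<Lambda> where "\<Lambda> = sqrt ((\<beta>\<^sup>2 + \<alpha>\<^sup>2) * exp ((1 + C) * L))"
  have \<Lambda>0: "\<Lambda> \<ge> 0" by (simp add: \<Lambda>_def)
  have \<Lambda>: "u x \<le> \<Lambda> * s" if s: "0 \<le> s" "s \<le> s1" and shot: "shot \<mu> s u v" and x: "x \<in> {0..L}" for s u v x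
  proof -
    have "(u x)\<^sup>2 + (v x)\<^sup>2 \<le> ((u 0)\<^sup>2 + (v 0)\<^sup>2) * exp ((1 + C) * \<bar>x - 0\<bar>)"
    proof (rule second_order_energy_bound[OF shot_deriv(1)[OF shot] shot_deriv(2)[OF shot] _ C(1)])
      show "\<bar>rhs \<mu> t (u t)\<bar> \<le> C * \<bar>u t\<bar>" if "t \<in> {0..L}" for t
        by (rule order_trans[OF C(2)[OF that U[OF s shot that]]]) (intro mult_left_mono C(1), simp)
    qed (use L x in auto)
    also have "\<dots> \<le> ((u 0)\<^sup>2 + (v 0)\<^sup>2) * exp ((1 + C) * L)"
      using x C by (intro mult_left_mono) auto
    also have "\<dots> = (\<Lambda> * s)\<^sup>2"
      using shot_init[OF shot] by (simp add: \<Lambda>_def power_mult_distrib algebra_simps)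
    finally have "(u x)\<^sup>2 \<le> (\<Lambda> * s)\<^sup>2" using zero_le_power2[of "v x"] by linarith
    then show ?thesis by (rule power2_le_imp_le) (use \<Lambda>0 s in simp)
  qed
  \<comment> \<open>The end value of the line \<open>\<beta> + \<alpha> * x\<close>. Below,
    \<open>\<epsilon> * D\<close> is the loss caused by \<open>G\<close>, likewise per unit of
    \<open>s0\<close>.\<close>
  define N where "N = \<gamma> * \<beta> + \<gamma> * \<alpha> * L + \<delta> * \<alpha>"
  have N: "N > 0"
  proof (cases "\<gamma> * \<alpha> = 0")
    case True
    then show ?thesis using coeffs by (auto simp: N_def algebra_simps)
  next
    case False
    then have "\<gamma> * \<alpha> * L > 0" using coeffs L by (simp add: less_le)
    moreover have "\<gamma> * \<beta> \<ge> 0" "\<delta> * \<alpha> \<ge> 0" using coeffs by auto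
    ultimately show ?thesis by (simp add: N_def)
  qed
  define D where "D = A * \<Lambda> * (\<gamma> * L * L + \<delta> * L)"
  have D: "D \<ge> 0" using A \<Lambda>0 coeffs L by (simp add: D_def)
  define \<epsilon> where "\<epsilon> = N / (D + 1)"
  have \<epsilon>: "\<epsilon> > 0" "\<epsilon> * D < N" using N D by (auto simp: \<epsilon>_def field_simps)
  obtain d where d: "d > 0" "\<And>y. 0 \<le> y \<Longrightarrow> y \<le> d \<Longrightarrow> G y \<le> \<epsilon> * y" using G_small[OF \<epsilon>(1)] by blast
  define s0 where "s0 = min (s1 / 2) (d / (\<Lambda> + 1))"
  have s0: "s0 > 0" "s0 < s1" using assms d \<Lambda>0 by (auto simp: s0_def min_less_iff_disj)
  have "(\<Lambda> + 1) * s0 \<le> (\<Lambda> + 1) * (d / (\<Lambda> + 1))" using \<Lambda>0 by (intro mult_left_mono) (auto simp: s0_def)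
  also have "\<dots> = d" using \<Lambda>0 by simp
  finally have s0d: "\<Lambda> * s0 \<le> d" using s0 by (simp add: algebra_simps)
  have "end_value u v > 0" if shot: "shot \<mu> s0 u v" for u v
  proof -
    define c where "c = A * (\<epsilon> * (\<Lambda> * s0))"
    have c: "c \<ge> 0" using A \<epsilon> \<Lambda>0 s0 by (simp add: c_def)
    have ac: "a t * G (u t) \<le> c" if t: "t \<in> {0..L}" for t
    proof -
      have ut: "u t \<le> \<Lambda> * s0" using \<Lambda>[OF _ _ shot t] s0 by simp
      have "G (u t) \<le> \<epsilon> * (\<Lambda> * s0)"
      proof (cases "u t \<le> 0")
        case True
        then show ?thesis using G_zero \<epsilon> \<Lambda>0 s0 by simp
      next
        case False
        then have "G (u t) \<le> \<epsilon> * u t" using ut s0d by (intro d) auto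
        also have "\<dots> \<le> \<epsilon> * (\<Lambda> * s0)" using ut \<epsilon> by (intro mult_left_mono) auto
        finally show ?thesis .
      qed
      then show ?thesis unfolding c_def using t A a_nonneg G_nonneg by (intro mult_mono) auto
    qed
    have "\<alpha> * s0 - c * L \<le> v L" "\<beta> * s0 + \<alpha> * s0 * L - c * L * L \<le> u L"
      using shot_lower[OF shot assms(2) c ac order_refl, of L] L by auto
    then have "\<delta> * (\<alpha> * s0 - c * L) \<le> \<delta> * v L" "\<gamma> * (\<beta> * s0 + \<alpha> * s0 * L - c * L * L) \<le> \<gamma> * u L"
      using coeffs by (auto intro: mult_left_mono)
    then have "\<delta> * (\<alpha> * s0 - c * L) + \<gamma> * (\<beta> * s0 + \<alpha> * s0 * L - c * L * L) \<le> end_value u v"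
      by (simp add: end_value_def)
    moreover have "\<delta> * (\<alpha> * s0 - c * L) + \<gamma> * (\<beta> * s0 + \<alpha> * s0 * L - c * L * L) = s0 * (N - \<epsilon> * D)"
      by (simp add: c_def N_def D_def algebra_simps)
    moreover have "s0 * (N - \<epsilon> * D) > 0" using s0 \<epsilon> by simp
    ultimately show ?thesis by linarith
  qed
  with s0 show ?thesis by blast
qed

section \<open>Three zeros by approximation\<close>

text \<open>This is not uniqueness for the initial value problem: \<open>u\<close> determines its
  derivative, and \<open>s\<close> is read off from \<open>u 0\<close> or \<open>v 0\<close>, as
  \<open>\<beta>\<close> or \<open>\<alpha>\<close> is positive.\<close>

lemma shot_unique:
  assumes "shot \<mu> s u v" "shot \<mu> s' u' v'" and eq: "\<And>x. x \<in> {0..L} \<Longrightarrow> u x = u' x"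
  shows "x \<in> {0..L} \<Longrightarrow> v x = v' x" "s = s'"
proof -
  have L: "0 < L" using order by simp
  have v: "v x = v' x" if x: "x \<in> {0..L}" for x
  proof -
    have "(u has_real_derivative v' x) (at x within {0..L})"
      using shot_deriv(1)[OF assms(2) x]
      by (rule has_field_derivative_transform_within[where d = 1]) (use x eq in auto)
    then show ?thesis
      using vector_derivative_unique_within_closed_interval[of 0 L x u "v x" "v' x"] L x
        shot_deriv(1)[OF assms(1) x]
      by (simp add: has_real_derivative_iff_has_vector_derivative)
  qed
  then show "x \<in> {0..L} \<Longrightarrow> v x = v' x" .
  show "s = s'"
    using eq[of 0] v[of 0] L shot_init[OF assms(1)] shot_init[OF assms(2)] coeff_pos by auto
qed

text \<open>By compactness, strict conditions on all exact shots pass to the approximations for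
  large \<open>n\<close>; the approximations have zeros by continuity in \<open>s\<close>; these
  zeros converge back to exact shots.\<close>

lemma three_shots_fixed:
  assumes \<mu>: "\<mu> \<ge> 0" and s: "0 < s0" "s0 < s1" "s1 < s2"
    and shot0: "\<And>u v. shot \<mu> s0 u v \<Longrightarrow> end_value u v > 0"
    and shot1: "\<And>u v. shot \<mu> s1 u v \<Longrightarrow> end_value u v < 0 \<and> v \<sigma> > r"
    and shot2: "\<And>u v. shot \<mu> s2 u v \<Longrightarrow> end_value u v < 0 \<and> v \<sigma> < r"
    and graze: "\<And>s u v. 0 < s \<Longrightarrow> s \<le> s2 \<Longrightarrow> shot \<mu> s u v \<Longrightarrow> v \<sigma> = r \<Longrightarrow> end_value u v > 0"
  shows "\<exists>sA uA vA sB uB vB sC uC vC.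
    shot \<mu> sA uA vA \<and> 0 < sA \<and> end_value uA vA = 0 \<and>
    shot \<mu> sB uB vB \<and> 0 < sB \<and> end_value uB vB = 0 \<and>
    shot \<mu> sC uC vC \<and> 0 < sC \<and> end_value uC vC = 0 \<and>
    (\<exists>x\<in>{0..L}. uA x \<noteq> uB x) \<and> (\<exists>x\<in>{0..L}. uA x \<noteq> uC x) \<and> (\<exists>x\<in>{0..L}. uB x \<noteq> uC x)"
proof -
  have L: "L > 0" using order by simp
  obtain U where U: "U > 0" "\<And>\<phi> s u v x. 0 \<le> s \<Longrightarrow> s \<le> s2 \<Longrightarrow>
    (\<forall>x\<in>{0..L}. \<forall>y. \<exists>y'. \<phi> x y \<le> rhs \<mu> x y') \<Longrightarrow> ivp_solution \<phi> L (\<beta> * s, \<alpha> * s) u v \<Longrightarrow> x \<in> {0..L} \<Longrightarrow> u x \<le> U"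
    using shot_upper[OF \<mu>, of s2] by metis
  \<comment> \<open>\<open>U\<close> bounds all shots, so clipping makes the right-hand side bounded without changing them.\<close>
  define \<phi> where "\<phi> x y = rhs \<mu> (max 0 (min L x)) (min U y)" for x y
  have clamp: "max 0 (min L x) \<in> {0..L}" for x using L by auto
  have cont\<phi>: "continuous_on UNIV (\<lambda>(x, y). \<phi> x y)"
  proof -
    have "continuous_on UNIV (\<lambda>z :: real \<times> real. a (max 0 (min L (fst z))))"
      "continuous_on UNIV (\<lambda>z :: real \<times> real. b (max 0 (min L (fst z))))"
      "continuous_on UNIV (\<lambda>z :: real \<times> real. G (min U (snd z)))"
      "continuous_on UNIV (\<lambda>z :: real \<times> real. K (min U (snd z)))"
      by (rule continuous_on_compose2[OF a_cont] continuous_on_compose2[OF b_cont]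
          continuous_on_compose2[OF G_cont] continuous_on_compose2[OF K_cont],
          intro continuous_intros, use clamp in auto)+
    then show ?thesis unfolding \<phi>_def rhs_def split_def by (intro continuous_intros)
  qed
  obtain C where C: "C \<ge> 0" "\<And>x y. x \<in> {0..L} \<Longrightarrow> y \<le> U \<Longrightarrow> \<bar>rhs \<mu> x y\<bar> \<le> C * max 0 y"
    using rhs_lin[OF \<mu>] by blast
  have bnd\<phi>: "\<bar>\<phi> x y\<bar> \<le> C * U" for x y
  proof -
    have "\<bar>\<phi> x y\<bar> \<le> C * max 0 (min U y)" unfolding \<phi>_def by (intro C clamp) simp
    also have "\<dots> \<le> C * U" using C U(1) by (intro mult_left_mono) auto
    finally show ?thesis .
  qed
  \<comment> \<open>Solutions of the clipped equation obey the bound \<open>U\<close> themselves, so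
    the clipping never acts on them.\<close>
  have sol: "shot \<mu> s u v" if "0 \<le> s" "s \<le> s2" and iv: "ivp_solution \<phi> L (\<beta> * s, \<alpha> * s) u v" for s u v
  proof -
    have "\<forall>x\<in>{0..L}. \<forall>y. \<exists>y'. \<phi> x y \<le> rhs \<mu> x y'" by (auto simp: \<phi>_def)
    then have "u x \<le> U" if "x \<in> {0..L}" for x using U(2) that iv \<open>0 \<le> s\<close> \<open>s \<le> s2\<close> by blast
    then have "\<phi> x (u x) = rhs \<mu> x (u x)" if "x \<in> {0..L}" for x
      using that by (simp add: \<phi>_def min_absorb2)
    then show ?thesis using iv by (simp add: shot_def ivp_solution_def)
  qed
  define Z where "Z s = (\<beta> * s, \<alpha> * s)" for s
  define F where "F n s = \<gamma> * tonelli_u \<phi> L n (Z s) L + \<delta> * tonelli_v \<phi> L n (Z s) L" for n s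
  define V where "V n s = tonelli_v \<phi> L n (Z s) \<sigma>" for n s
  have cZ: "continuous_on S Z" for S unfolding Z_def by (intro continuous_intros)
  have cF: "continuous_on S (F n)" and cV: "continuous_on S (V n)" for S n
    unfolding F_def V_def
    by (intro continuous_intros continuous_on_compose2[OF tonelli_continuous(1)[OF cont\<phi>] cZ]
        continuous_on_compose2[OF tonelli_continuous(2)[OF cont\<phi>] cZ] subset_UNIV)+
  have limit: "\<exists>k s u v. strict_mono (k :: nat \<Rightarrow> nat) \<and> s \<in> {lo..hi} \<and> shot \<mu> s u v \<and>
      (\<lambda>n. F (m (k n)) (t (k n))) \<longlonglongrightarrow> end_value u v \<and> (\<lambda>n. V (m (k n)) (t (k n))) \<longlonglongrightarrow> v \<sigma>"
    if m: "strict_mono m" and t: "\<And>n. t n \<in> {lo..hi}" and "0 \<le> lo" "hi \<le> s2" for m t lo hi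
  proof -
    have cQ: "compact (Z ` {lo..hi})" by (intro compact_continuous_image cZ compact_Icc)
    have tQ: "Z (t n) \<in> Z ` {lo..hi}" for n using t by blast
    obtain k z0 u v where k: "strict_mono (k :: nat \<Rightarrow> nat)" "z0 \<in> Z ` {lo..hi}"
      "(\<lambda>n. Z (t (k n))) \<longlonglongrightarrow> z0" "ivp_solution \<phi> L z0 u v"
      "\<And>x. x \<in> {0..L} \<Longrightarrow> (\<lambda>n. tonelli_u \<phi> L (m (k n)) (Z (t (k n))) x) \<longlonglongrightarrow> u x"
      "\<And>x. x \<in> {0..L} \<Longrightarrow> (\<lambda>n. tonelli_v \<phi> L (m (k n)) (Z (t (k n))) x) \<longlonglongrightarrow> v x"
      by (rule tonelli_limit[where z = "\<lambda>n. Z (t n)", OF cont\<phi> bnd\<phi> L cQ tQ m]) (rule that)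
    from k(2) obtain s where s: "s \<in> {lo..hi}" "z0 = Z s" by blast
    have "shot \<mu> s u v" using sol[of s u v] k(4) s that by (auto simp: Z_def)
    moreover have "(\<lambda>n. F (m (k n)) (t (k n))) \<longlonglongrightarrow> end_value u v"
      unfolding F_def end_value_def using L by (intro tendsto_intros k) auto
    moreover have "(\<lambda>n. V (m (k n)) (t (k n))) \<longlonglongrightarrow> v \<sigma>"
      unfolding V_def using order by (intro k) auto
    ultimately show ?thesis using k(1) s(1) by blast
  qed
  \<comment> \<open>Otherwise infinitely many approximations enter the closed set \<open>S\<close>,
    and a limit of them is an exact shot in \<open>S\<close>. The closed sets used below are the
    complements of the desired strict conditions.\<close>
  have avoid: "\<forall>\<^sub>F n in sequentially. \<forall>s\<in>{lo..hi}. (F n s, V n s) \<notin> S"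
    if S: "closed S" and none: "\<And>s u v. s \<in> {lo..hi} \<Longrightarrow> shot \<mu> s u v \<Longrightarrow> (end_value u v, v \<sigma>) \<notin> S"
      and lohi: "0 \<le> lo" "hi \<le> s2" for S lo hi
  proof (rule ccontr)
    assume "\<not> ?thesis"
    then obtain m where m: "strict_mono (m :: nat \<Rightarrow> nat)" "\<And>n. \<exists>s\<in>{lo..hi}. (F (m n) s, V (m n) s) \<in> S"
      using not_eventually_sequentiallyD by fastforce
    then obtain t where t: "\<And>n. t n \<in> {lo..hi}" "\<And>n. (F (m n) (t n), V (m n) (t n)) \<in> S"
      by metis
    obtain k s u v where k: "s \<in> {lo..hi}" "shot \<mu> s u v"
      "(\<lambda>n. F (m (k n)) (t (k n))) \<longlonglongrightarrow> end_value u v" "(\<lambda>n. V (m (k n)) (t (k n))) \<longlonglongrightarrow> v \<sigma>"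
      using limit[where t = t, OF m(1) t(1) lohi] by blast
    have "(end_value u v, v \<sigma>) \<in> S"
      by (rule closed_sequentially[OF S _ tendsto_Pair[OF k(3,4)]]) (rule t)
    then show False using none[OF k(1,2)] by blast
  qed
  have ev0: "\<forall>\<^sub>F n in sequentially. \<forall>s\<in>{s0..s0}. (F n s, V n s) \<notin> {z. fst z \<le> 0}"
    using s shot0 by (intro avoid closed_Collect_le continuous_intros) force+
  have ev1: "\<forall>\<^sub>F n in sequentially. \<forall>s\<in>{s1..s1}. (F n s, V n s) \<notin> {z. 0 \<le> fst z \<or> snd z \<le> r}"
    using s shot1 by (intro avoid closed_Collect_disj closed_Collect_le continuous_intros) force+
  have ev2: "\<forall>\<^sub>F n in sequentially. \<forall>s\<in>{s2..s2}. (F n s, V n s) \<notin> {z. 0 \<le> fst z \<or> r \<le> snd z}"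
    using s shot2 by (intro avoid closed_Collect_disj closed_Collect_le continuous_intros) force+
  have none: "(end_value u v, v \<sigma>) \<notin> {z. fst z \<le> 0 \<and> snd z = r}"
    if "s \<in> {s1..s2}" "shot \<mu> s u v" for s u v
  proof -
    have "0 < s" "s \<le> s2" using that(1) s by auto
    from graze[OF this that(2)] show ?thesis by auto
  qed
  have evg: "\<forall>\<^sub>F n in sequentially. \<forall>s\<in>{s1..s2}. (F n s, V n s) \<notin> {z. fst z \<le> 0 \<and> snd z = r}"
    by (rule avoid[OF _ none]) (use s in \<open>auto intro!: closed_Collect_conj closed_Collect_le closed_Collect_eq continuous_intros\<close>)
  obtain N where N: "\<And>n. n \<ge> N \<Longrightarrow> F n s0 > 0 \<and> F n s1 < 0 \<and> V n s1 > r \<and> F n s2 < 0 \<and> V n s2 < r \<and>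
      (\<forall>s\<in>{s1..s2}. V n s = r \<longrightarrow> F n s > 0)"
    using eventually_conj[OF eventually_conj[OF ev0 ev1] eventually_conj[OF ev2 evg]]
    unfolding eventually_sequentially by (auto simp: not_le)
  \<comment> \<open>The shift by \<open>N\<close> provides a zero for every \<open>n\<close>, as the
    limit argument expects.\<close>
  have "\<exists>s\<in>{s0..s1}. F (n + N) s = 0" for n
    using IVT2'[of "F (n + N)" s1 0 s0] N[of "n + N"] s cF by fastforce
  then obtain tA where tA: "\<And>n. tA n \<in> {s0..s1}" "\<And>n. F (n + N) (tA n) = 0" by metis
  have "\<exists>s\<in>{s1..s2}. F (n + N) s = 0 \<and> V (n + N) s \<ge> r" for n
    using N[of "n + N"] s by (intro zero_before_level cF cV) auto
  then obtain tB where tB: "\<And>n. tB n \<in> {s1..s2}" "\<And>n. F (n + N) (tB n) = 0" "\<And>n. V (n + N) (tB n) \<ge> r"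
    by metis
  have "\<exists>s\<in>{s1..s2}. F (n + N) s = 0 \<and> V (n + N) s \<le> r" for n
    using N[of "n + N"] s by (intro zero_after_level cF cV) auto
  then obtain tC where tC: "\<And>n. tC n \<in> {s1..s2}" "\<And>n. F (n + N) (tC n) = 0" "\<And>n. V (n + N) (tC n) \<le> r"
    by metis
  have mN: "strict_mono (\<lambda>n. n + N)" by (simp add: strict_mono_def)
  obtain kA sA uA vA where A: "sA \<in> {s0..s1}" "shot \<mu> sA uA vA"
    "(\<lambda>n. F (kA n + N) (tA (kA n))) \<longlonglongrightarrow> end_value uA vA"
    using limit[where t = tA, OF mN tA(1)] s by auto
  obtain kB sB uB vB where B: "sB \<in> {s1..s2}" "shot \<mu> sB uB vB"
    "(\<lambda>n. F (kB n + N) (tB (kB n))) \<longlonglongrightarrow> end_value uB vB" "(\<lambda>n. V (kB n + N) (tB (kB n))) \<longlonglongrightarrow> vB \<sigma>"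
    using limit[where t = tB, OF mN tB(1)] s by auto
  obtain kC sC uC vC where C: "sC \<in> {s1..s2}" "shot \<mu> sC uC vC"
    "(\<lambda>n. F (kC n + N) (tC (kC n))) \<longlonglongrightarrow> end_value uC vC" "(\<lambda>n. V (kC n + N) (tC (kC n))) \<longlonglongrightarrow> vC \<sigma>"
    using limit[where t = tC, OF mN tC(1)] s by auto
  have zero: "end_value uA vA = 0" "end_value uB vB = 0" "end_value uC vC = 0"
    using A(3) B(3) C(3) by (simp_all add: tA tB tC LIMSEQ_const_iff)
  have vB: "vB \<sigma> \<ge> r" by (rule tendsto_lowerbound[OF B(4)]) (simp_all add: tB)
  have vC: "vC \<sigma> \<le> r" by (rule tendsto_upperbound[OF C(4)]) (simp_all add: tC)
  \<comment> \<open>The limit could a priori reach the common endpoint \<open>s1\<close>, but every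
    shot from there has a negative end value.\<close>
  have sA: "sA < s1" using shot1[of uA vA] A zero(1) by (cases "sA = s1") auto
  have "\<exists>x\<in>{0..L}. uA x \<noteq> uB x"
    using shot_unique(2)[OF A(2) B(2)] sA B(1) by fastforce
  moreover have "\<exists>x\<in>{0..L}. uA x \<noteq> uC x"
    using shot_unique(2)[OF A(2) C(2)] sA C(1) by fastforce
  moreover have "\<exists>x\<in>{0..L}. uB x \<noteq> uC x"
  proof (rule ccontr)
    assume "\<not> ?thesis"
    then have "vB \<sigma> = vC \<sigma>" using shot_unique(1)[OF B(2) C(2), of \<sigma>] order by auto
    then have "vB \<sigma> = r" using vB vC by simp
    then show False using graze[OF _ _ B(2)] B(1) s zero(2) by auto
  qed
  moreover have "0 < sA" "0 < sB" "0 < sC" using A(1) B(1) C(1) s by auto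
  ultimately show ?thesis using A(2) B(2) C(2) zero by blast
qed

text \<open>The order of choices matters: \<open>s2\<close> is free of \<open>\<mu>\<close>,
  \<open>r\<close> depends on \<open>s2\<close>, the threshold \<open>\<mu>2\<close> depends on
  \<open>r\<close>, and \<open>s0\<close> is chosen last, for the given
  \<open>\<mu>\<close>.\<close>

lemma three_shots:
  "\<exists>\<mu>0>0. \<forall>\<mu>>\<mu>0. \<exists>sA uA vA sB uB vB sC uC vC.
    shot \<mu> sA uA vA \<and> 0 < sA \<and> end_value uA vA = 0 \<and>
    shot \<mu> sB uB vB \<and> 0 < sB \<and> end_value uB vB = 0 \<and>
    shot \<mu> sC uC vC \<and> 0 < sC \<and> end_value uC vC = 0 \<and>
    (\<exists>x\<in>{0..L}. uA x \<noteq> uB x) \<and> (\<exists>x\<in>{0..L}. uA x \<noteq> uC x) \<and> (\<exists>x\<in>{0..L}. uB x \<noteq> uC x)"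
proof -
  obtain s2 where s2: "s2 > 0"
    "\<forall>\<mu>\<ge>0. \<forall>u v. shot \<mu> s2 u v \<longrightarrow> end_value u v < 0 \<and> v \<sigma> < 0"
    using large_shot by blast
  obtain r \<mu>1 where r: "r > 0" "\<mu>1 \<ge> 0"
    "\<forall>\<mu>\<ge>\<mu>1. \<forall>s u v. 0 < s \<longrightarrow> s \<le> s2 \<longrightarrow> shot \<mu> s u v \<longrightarrow> v \<sigma> = r \<longrightarrow> end_value u v > 0"
    using grazing_shot[OF s2(1)] by blast
  obtain s1 \<mu>2 where s1: "0 < s1" "s1 < s2" "\<mu>2 \<ge> 0"
    "\<forall>\<mu>\<ge>\<mu>2. \<forall>u v. shot \<mu> s1 u v \<longrightarrow> end_value u v < 0 \<and> v \<sigma> > r"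
    using medium_shot[OF s2(1)] by blast
  show ?thesis
  proof (rule exI[of _ "max \<mu>1 \<mu>2 + 1"], intro conjI allI impI)
    show "max \<mu>1 \<mu>2 + 1 > 0" using r by simp
    fix \<mu> assume "\<mu> > max \<mu>1 \<mu>2 + 1"
    then have \<mu>: "\<mu> \<ge> 0" "\<mu> \<ge> \<mu>1" "\<mu> \<ge> \<mu>2" using r by auto
    obtain s0 where s0: "s0 > 0" "s0 < s1" "\<forall>u v. shot \<mu> s0 u v \<longrightarrow> end_value u v > 0"
      using small_shot[OF s1(1) \<mu>(1)] by blast
    have shot2: "end_value u v < 0 \<and> v \<sigma> < r" if "shot \<mu> s2 u v" for u v
      using s2(2) \<mu>(1) that r(1) by force
    show "\<exists>sA uA vA sB uB vB sC uC vC.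
      shot \<mu> sA uA vA \<and> 0 < sA \<and> end_value uA vA = 0 \<and>
      shot \<mu> sB uB vB \<and> 0 < sB \<and> end_value uB vB = 0 \<and>
      shot \<mu> sC uC vC \<and> 0 < sC \<and> end_value uC vC = 0 \<and>
      (\<exists>x\<in>{0..L}. uA x \<noteq> uB x) \<and> (\<exists>x\<in>{0..L}. uA x \<noteq> uC x) \<and> (\<exists>x\<in>{0..L}. uB x \<noteq> uC x)"
      using s0 s1(4) r(3) \<mu> by (intro three_shots_fixed[OF \<mu>(1) s0(1,2) s1(2) _ _ shot2]) blast+
  qed
qed

end

section \<open>The boundary value problem\<close>

text \<open>A bounded derivative yields a Lipschitz constant \<open>C\<close>, and
  \<open>\<epsilon> / C\<close> serves as the modulus.\<close>

lemma abs_continuous_on_C1: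
  assumes d: "\<And>x. x \<in> {lo..hi} \<Longrightarrow> (f has_real_derivative f' x) (at x within {lo..hi})"
    and c: "continuous_on {lo..hi} f'"
  shows "abs_continuous_on lo hi f"
proof -
  have "bounded (f' ` {lo..hi})"
    by (intro compact_imp_bounded compact_continuous_image c compact_Icc)
  then obtain C where C: "C > 0" "\<And>x. x \<in> {lo..hi} \<Longrightarrow> \<bar>f' x\<bar> \<le> C"
    unfolding bounded_pos by auto
  have lip: "\<bar>f t - f s\<bar> \<le> C * (t - s)" if "lo \<le> s" "s \<le> t" "t \<le> hi" for s t
  proof -
    have sub: "{s..t} \<subseteq> {lo..hi}" using that by auto
    have "f t - f s \<le> C * (t - s)"
      by (rule increment_le[OF that(2) sub d]) (use sub C(2) in \<open>auto simp: abs_le_iff\<close>)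
    moreover have "- C * (t - s) \<le> f t - f s"
      by (rule increment_ge[OF that(2) sub d]) (use sub C(2) in \<open>auto simp: abs_le_iff minus_le_iff\<close>)
    ultimately show ?thesis by (simp add: abs_le_iff)
  qed
  show ?thesis
    unfolding abs_continuous_on_def
  proof (intro allI impI, rule exI[where x = "\<epsilon> / C" for \<epsilon>], intro conjI allI impI)
    fix \<epsilon> :: real assume \<epsilon>: "\<epsilon> > 0"
    then show "\<epsilon> / C > 0" using C by simp
    fix n :: nat and s t :: "nat \<Rightarrow> real"
    assume H: "(\<forall>i<n. lo \<le> s i \<and> s i \<le> t i \<and> t i \<le> hi) \<and>
        (\<forall>i<n. \<forall>j<n. i \<noteq> j \<longrightarrow> t i \<le> s j \<or> t j \<le> s i) \<and> (\<Sum>i<n. t i - s i) < \<epsilon> / C"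
    have "(\<Sum>i<n. \<bar>f (t i) - f (s i)\<bar>) \<le> (\<Sum>i<n. C * (t i - s i))"
      using H by (intro sum_mono lip) auto
    also have "\<dots> = C * (\<Sum>i<n. t i - s i)" by (simp add: sum_distrib_left)
    also have "\<dots> < C * (\<epsilon> / C)" using H C by (intro mult_strict_left_mono) auto
    also have "\<dots> = \<epsilon>" using C by simp
    finally show "(\<Sum>i<n. \<bar>f (t i) - f (s i)\<bar>) < \<epsilon>" .
  qed
qed

text \<open>One-sided derivatives on the closed interval are two-sided except at \<open>0\<close>
  and \<open>L\<close>, a null set; the second derivative is continuous, so \<open>u\<close> and
  \<open>v\<close> are both continuously differentiable.\<close>

lemma bvp_solutionI:
  assumes L: "L > 0" and nonneg: "\<And>x. x \<in> {0..L} \<Longrightarrow> u x \<ge> 0"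
    and u: "\<And>x. x \<in> {0..L} \<Longrightarrow> (u has_real_derivative v x) (at x within {0..L})"
    and v: "\<And>x. x \<in> {0..L} \<Longrightarrow>
      (v has_real_derivative (\<mu> * b x * k (u x) - a x * g (u x))) (at x within {0..L})"
    and a: "continuous_on {0..L} a" and b: "continuous_on {0..L} b"
    and g: "continuous_on {0..} g" and k: "continuous_on {0..} k"
    and bc: "\<alpha> * u 0 - \<beta> * v 0 = 0" "\<gamma> * u L + \<delta> * v L = 0"
  shows "bvp_solution L \<alpha> \<beta> \<gamma> \<delta> a g b k \<mu> u"
proof -
  have cu: "continuous_on {0..L} u" and cv: "continuous_on {0..L} v"
    by (rule DERIV_continuous_on[OF u] DERIV_continuous_on[OF v]; assumption)+
  have "continuous_on {0..L} (\<lambda>x. \<mu> * b x * k (u x) - a x * g (u x))"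
    by (intro continuous_intros a b continuous_on_compose2[OF g cu] continuous_on_compose2[OF k cu])
      (use nonneg in auto)
  then have ac: "abs_continuous_on 0 L u" "abs_continuous_on 0 L v"
    by (auto intro: abs_continuous_on_C1[OF u cv] abs_continuous_on_C1[OF v])
  have null: "AE x in lborel. x \<notin> {0, L}"
    by (intro AE_not_in finite_imp_null_set_lborel) simp
  have interior: "at x within {0..L} = at x" if "x \<in> {0..L}" "x \<notin> {0, L}" for x
    using that by (intro at_within_interior) auto
  have "AE x in lborel. x \<in> {0..L} \<longrightarrow> (u has_real_derivative v x) (at x)"
    using null by eventually_elim (use u interior in metis)
  moreover have "AE x in lborel. x \<in> {0..L} \<longrightarrow>
      (\<exists>w. (v has_real_derivative w) (at x) \<and> w + a x * g (u x) - \<mu> * b x * k (u x) = 0)"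
    using null
  proof eventually_elim
    case (elim x)
    show ?case
    proof
      assume x: "x \<in> {0..L}"
      have "(v has_real_derivative (\<mu> * b x * k (u x) - a x * g (u x))) (at x)"
        using v[OF x] unfolding interior[OF x elim] .
      then show "\<exists>w. (v has_real_derivative w) (at x) \<and> w + a x * g (u x) - \<mu> * b x * k (u x) = 0"
        by (intro exI[of _ "\<mu> * b x * k (u x) - a x * g (u x)"]) simp
    qed
  qed
  ultimately show ?thesis
    unfolding bvp_solution_def using ac nonneg bc by blast
qed

section \<open>Positivity and boundedness of the solutions found\<close>

text \<open>A zero inside \<open>]0,L[\<close>, or a negative value at \<open>L\<close>, would make
  the end value negative.\<close>

lemma (in shooting) zero_end_value_pos:
  assumes shot: "shot \<mu> s u v" and \<mu>: "\<mu> \<ge> 0" and s: "s > 0" and zero: "end_value u v = 0"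
  shows "x \<in> {0<..<L} \<Longrightarrow> u x > 0" "x \<in> {0..L} \<Longrightarrow> u x \<ge> 0"
proof -
  show pos: "u x > 0" if "x \<in> {0<..<L}" for x
  proof (rule ccontr)
    assume "\<not> u x > 0"
    then show False using shot_hits_zero(2)[OF shot \<mu> s, of x] that zero by auto
  qed
  have "u L \<ge> 0"
  proof (rule ccontr)
    assume "\<not> u L \<ge> 0"
    then have neg: "u L < 0" "v L < 0" using shot_hits_zero(1)[OF shot \<mu> s, of L L] order by auto
    then have "\<gamma> * u L \<le> 0" "\<delta> * v L \<le> 0" "\<gamma> * u L < 0 \<or> \<delta> * v L < 0"
      using coeffs coeff_pos by (auto simp: mult_nonneg_nonpos mult_pos_neg)
    then show False using zero by (auto simp: end_value_def)
  qed
  moreover have "u 0 \<ge> 0" using shot_init[OF shot] coeffs s by simp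
  ultimately show "u x \<ge> 0" if "x \<in> {0..L}"
    using pos[of x] that by (cases "x = 0 \<or> x = L") auto
qed

text \<open>On the outer intervals the bound is that for \<open>nonneg_solution\<close>; on
  \<open>[\<tau>,\<sigma>]\<close> the function is convex and so lies below the larger of its two
  end values. This keeps the truncation of \<open>k\<close> out of the final solutions.\<close>

lemma (in shooting) zero_end_value_bound:
  assumes shot: "shot \<mu> s u v" and \<mu>: "\<mu> \<ge> 0" and s: "s > 0" and zero: "end_value u v = 0"
    and M1: "\<And>u v x. nonneg_solution a G 0 \<tau> u v \<Longrightarrow> x \<in> {0..\<tau>} \<Longrightarrow> u x \<le> M"
    and M2: "\<And>u v x. nonneg_solution a G \<sigma> L u v \<Longrightarrow> x \<in> {\<sigma>..L} \<Longrightarrow> u x \<le> M"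
    and x: "x \<in> {0..L}"
  shows "u x \<le> M"
proof -
  have ns: "nonneg_solution a G p q u v" if "0 \<le> p" "q \<le> L" "{p..q} \<subseteq> {0..\<tau>} \<union> {\<sigma>..L}" for p q
    unfolding nonneg_solution_def
  proof
    fix x assume x: "x \<in> {p..q}"
    have "rhs \<mu> x (u x) = - a x * G (u x)" using b_zero[of x] x that by (auto simp: rhs_def)
    then show "u x \<ge> 0 \<and> (u has_real_derivative v x) (at x within {p..q}) \<and>
        (v has_real_derivative - a x * G (u x)) (at x within {p..q})"
      using ivp_solution_subinterval[OF shot[unfolded shot_def] that(1,2) x]
        zero_end_value_pos(2)[OF shot \<mu> s zero, of x] x that by auto
  qed
  have left: "u x \<le> M" if "x \<in> {0..\<tau>}" for x by (rule M1[OF ns that]) (use order in auto)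
  have right: "u x \<le> M" if "x \<in> {\<sigma>..L}" for x by (rule M2[OF ns that]) (use order in auto)
  consider "x \<in> {0..\<tau>}" | "x \<in> {\<sigma>..L}" | "\<tau> < x" "x < \<sigma>" "v x \<le> 0" | "\<tau> < x" "x < \<sigma>" "v x > 0"
    using x by force
  then show ?thesis
  proof cases
    case 3
    have "u x - u \<tau> \<le> 0 * (x - \<tau>)"
    proof (rule increment_le[where S = "{0..L}" and f' = v])
      fix t assume t: "t \<in> {\<tau>..x}"
      then show "(u has_real_derivative v t) (at t within {0..L})"
        using 3 order by (intro shot_deriv(1)[OF shot]) auto
      show "v t \<le> 0" using shot_slope_convex[OF shot \<mu>, of t x] 3 t by auto
    qed (use 3 order in auto)
    then show ?thesis using left[of \<tau>] order by simp
  next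
    case 4
    have "0 * (\<sigma> - x) \<le> u \<sigma> - u x"
    proof (rule increment_ge[where S = "{0..L}" and f' = v])
      fix t assume t: "t \<in> {x..\<sigma>}"
      then show "(u has_real_derivative v t) (at t within {0..L})"
        using 4 order by (intro shot_deriv(1)[OF shot]) auto
      show "0 \<le> v t" using shot_slope_convex[OF shot \<mu>, of x t] 4 t by auto
    qed (use 4 order in auto)
    then show ?thesis using right[of \<sigma>] order by simp
  qed (use left right in auto)
qed

theorem theorem1p1:
  fixes L \<alpha> \<beta> \<gamma> \<delta> \<tau> \<sigma> :: real and a b g k :: "real \<Rightarrow> real"
  assumes "L > 0"
    and "\<alpha> \<ge> 0" "\<beta> \<ge> 0" "\<gamma> \<ge> 0" "\<delta> \<ge> 0"
    and "\<gamma> * \<beta> + \<alpha> * \<gamma> + \<alpha> * \<delta> > 0"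
    and "continuous_on {0..L} a" "\<forall>x\<in>{0..L}. a x \<ge> 0"
    and "continuous_on {0..L} b" "\<forall>x\<in>{0..L}. b x \<ge> 0"
    and "0 < \<tau>" "\<tau> < \<sigma>" "\<sigma> < L"
    and "\<forall>x\<in>{0<..<\<tau>} \<union> {\<sigma><..<L}. a x > 0"
    and "\<forall>x\<in>{\<tau>..\<sigma>}. a x = 0"
    and "\<forall>x\<in>{\<tau><..<\<sigma>}. b x > 0"
    and "\<forall>x\<in>{0..\<tau>} \<union> {\<sigma>..L}. b x = 0"
    and "continuous_on {0..} g" "\<forall>s\<ge>0. g s \<ge> 0"
    and "continuous_on {0..} k" "\<forall>s\<ge>0. k s \<ge> 0"
    and "g 0 = 0" "k 0 = 0"
    and "\<forall>s>0. g s > 0" "\<forall>s>0. k s > 0"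
    and "Limsup (at_right 0) (\<lambda>s. ereal (g s / s)) = 0"
    and "Liminf at_top (\<lambda>s. ereal (g s / s)) = \<infinity>"
    and "Limsup (at_right 0) (\<lambda>s. ereal (k s / s)) < \<infinity>"
  shows "\<exists>\<mu>\<^sub>0 > 0. \<forall>\<mu> > \<mu>\<^sub>0. \<exists>u1 u2 u3.
           bvp_solution L \<alpha> \<beta> \<gamma> \<delta> a g b k \<mu> u1 \<and> positive_on_open L u1 \<and>
           bvp_solution L \<alpha> \<beta> \<gamma> \<delta> a g b k \<mu> u2 \<and> positive_on_open L u2 \<and>
           bvp_solution L \<alpha> \<beta> \<gamma> \<delta> a g b k \<mu> u3 \<and> positive_on_open L u3 \<and>
           (\<exists>x\<in>{0..L}. u1 x \<noteq> u2 x) \<and> (\<exists>x\<in>{0..L}. u1 x \<noteq> u3 x) \<and>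
           (\<exists>x\<in>{0..L}. u2 x \<noteq> u3 x)"
proof -
  note L = assms(1) and coeffs = assms(2-6) and a = assms(7,8) and b = assms(9,10) and order = assms(11-13)
  note weights = assms(14-17) and g = assms(18,19) and k = assms(20,21) and gk0 = assms(22,23)
  note gpos = assms(24) and kpos = assms(25) and lim = assms(26-28)
  define G where "G y = g (max 0 y)" for y
  have G_cont: "continuous_on UNIV G"
    unfolding G_def by (intro continuous_on_compose2[OF g(1)] continuous_intros) auto
  have G_large: "\<exists>S>0. \<forall>y\<ge>S. m * y \<le> G y" for m
  proof -
    have "\<forall>\<^sub>F s in at_top. ereal m < ereal (g s / s)"
      using lim(2) by (intro less_LiminfD) simp
    then obtain S where S: "\<And>s. s \<ge> S \<Longrightarrow> m < g s / s"
      unfolding eventually_at_top_linorder by auto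
    have "m * y \<le> G y" if "y \<ge> max S 1" for y
      using S[of y] that by (simp add: G_def max_absorb2 pos_less_divide_eq)
    then show ?thesis by (intro exI[of _ "max S 1"]) auto
  qed
  have G_small: "\<exists>d>0. \<forall>y. 0 \<le> y \<and> y \<le> d \<longrightarrow> G y \<le> \<epsilon> * y" if "\<epsilon> > 0" for \<epsilon>
  proof -
    have "\<forall>\<^sub>F s in at_right 0. ereal (g s / s) < ereal \<epsilon>"
      using lim(1) that by (intro Limsup_lessD) simp
    then obtain d where d: "d > 0" "\<And>s. 0 < s \<Longrightarrow> s < d \<Longrightarrow> g s / s < \<epsilon>"
      unfolding eventually_at_right_field by auto
    have "G y \<le> \<epsilon> * y" if "0 \<le> y" "y \<le> d / 2" for y
      using d(1) d(2)[of y] that gk0 by (cases "y = 0") (auto simp: G_def max_absorb2 pos_divide_less_eq)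
    then show ?thesis using d(1) by (intro exI[of _ "d / 2"]) auto
  qed
  have G_nonneg: "G y \<ge> 0" for y using g(2) by (simp add: G_def)
  have "\<exists>M>0. \<forall>u v x. nonneg_solution a G 0 \<tau> u v \<longrightarrow> x \<in> {0..\<tau>} \<longrightarrow> u x \<le> M"
    using order a weights G_nonneg G_large
    by (intro nonneg_solution_bound continuous_on_subset[OF a(1)]) auto
  then obtain M1 where M1: "\<And>u v x. nonneg_solution a G 0 \<tau> u v \<Longrightarrow> x \<in> {0..\<tau>} \<Longrightarrow> u x \<le> M1"
    by blast
  have "\<exists>M>0. \<forall>u v x. nonneg_solution a G \<sigma> L u v \<longrightarrow> x \<in> {\<sigma>..L} \<longrightarrow> u x \<le> M"
    using order a weights G_nonneg G_large
    by (intro nonneg_solution_bound continuous_on_subset[OF a(1)]) auto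
  then obtain M2 where M2: "\<And>u v x. nonneg_solution a G \<sigma> L u v \<Longrightarrow> x \<in> {\<sigma>..L} \<Longrightarrow> u x \<le> M2"
    by blast
  \<comment> \<open>Fixed before \<open>\<mu>\<close>, since \<open>M1\<close> and \<open>M2\<close>
    come from the outer intervals alone. Beyond \<open>R\<close> the truncated function keeps the
    positive value \<open>k R\<close>, so it is bounded and yet bounded below away from the
    origin.\<close>
  define R where "R = max 1 (max M1 M2)"
  have R: "R > 0" "M1 \<le> R" "M2 \<le> R" by (auto simp: R_def)
  define K where "K y = k (max 0 (min y R))" for y
  have K_cont: "continuous_on UNIV K"
    unfolding K_def by (intro continuous_on_compose2[OF k(1)] continuous_intros) auto
  have K_nonneg: "K y \<ge> 0" for y using k(2) by (simp add: K_def)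
  have cR: "continuous_on {p..R} k" if "p \<ge> 0" for p
    using that by (intro continuous_on_subset[OF k(1)]) auto
  obtain ym where ym: "ym \<in> {0..R}" "\<And>y. y \<in> {0..R} \<Longrightarrow> k y \<le> k ym"
    using continuous_attains_sup[OF _ _ cR[of 0]] R(1) by auto
  have K_le: "K y \<le> k ym" for y using ym(2)[of "max 0 (min y R)"] R(1) by (auto simp: K_def)
  have kym: "k ym \<ge> 0" using k(2) ym(1) by auto
  have K_lin: "\<exists>C\<ge>0. \<forall>y. K y \<le> C * max 0 y"
  proof -
    obtain c :: nat where c: "Limsup (at_right 0) (\<lambda>s. ereal (k s / s)) < ereal (real c)"
      using lim(3) less_PInf_Ex_of_nat by (metis order_less_irrefl)
    have "\<forall>\<^sub>F s in at_right 0. ereal (k s / s) < ereal (real c)" by (rule Limsup_lessD[OF c])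
    then obtain d where d: "d > 0" "\<And>s. 0 < s \<Longrightarrow> s < d \<Longrightarrow> k s / s < real c"
      unfolding eventually_at_right_field by auto
    \<comment> \<open>Below \<open>e\<close> the truncation is inactive and the quotient bound
      holds; above \<open>e\<close> the constant bound \<open>k ym\<close> is converted into a
      linear one.\<close>
    define e where "e = min d R"
    have e: "e > 0" "e \<le> d" "e \<le> R" using d(1) R(1) by (auto simp: e_def)
    have "K y \<le> (real c + k ym / e) * max 0 y" for y
    proof -
      consider "y \<le> 0" | "0 < y" "y < e" | "e \<le> y" "y > 0" by linarith
      then show ?thesis
      proof cases
        case 1
        then show ?thesis using gk0 R(1) by (simp add: K_def)
      next
        case 2
        then have "K y \<le> real c * y"
          using d(2)[of y] e by (simp add: K_def pos_divide_less_eq)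
        also have "\<dots> \<le> (real c + k ym / e) * y"
          using 2 e kym by (intro mult_right_mono) auto
        finally show ?thesis using 2 by simp
      next
        case 3
        have "K y \<le> k ym / e * e" using K_le[of y] e(1) by simp
        also have "\<dots> \<le> k ym / e * y" using 3 kym e(1) by (intro mult_left_mono divide_nonneg_pos) auto
        also have "\<dots> \<le> (real c + k ym / e) * y" using 3 by (intro mult_right_mono) auto
        finally show ?thesis using 3 by simp
      qed
    qed
    moreover have "real c + k ym / e \<ge> 0" using kym e by simp
    ultimately show ?thesis by blast
  qed
  have K_lower: "\<exists>c>0. \<forall>y\<ge>\<eta>. c \<le> K y" if "\<eta> > 0" for \<eta>
  proof -
    \<comment> \<open>Truncated arguments stay in the compact interval \<open>[\<eta>',R]\<close>,
      on which \<open>k\<close> has a positive minimum.\<close>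
    define \<eta>' where "\<eta>' = min \<eta> R"
    have \<eta>': "\<eta>' > 0" "\<eta>' \<le> R" using that R(1) by (auto simp: \<eta>'_def)
    obtain y0 where y0: "y0 \<in> {\<eta>'..R}" "\<And>y. y \<in> {\<eta>'..R} \<Longrightarrow> k y0 \<le> k y"
      using continuous_attains_inf[OF _ _ cR[of \<eta>']] \<eta>' by auto
    have "k y0 \<le> K y" if "y \<ge> \<eta>" for y
    proof -
      have "max 0 (min y R) \<in> {\<eta>'..R}" using that \<eta>' R(1) by (auto simp: \<eta>'_def)
      then show ?thesis unfolding K_def by (rule y0(2))
    qed
    moreover have "k y0 > 0" using kpos y0(1) \<eta>' by auto
    ultimately show ?thesis by blast
  qed
  interpret shooting L \<alpha> \<beta> \<gamma> \<delta> \<tau> \<sigma> a b G K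
  proof unfold_locales
    show "\<exists>C\<ge>0. \<forall>y. K y \<le> C" using K_le kym by blast
    show "G y = 0" if "y \<le> 0" for y using that gk0 by (simp add: G_def)
    show "G y > 0" if "y > 0" for y using that gpos by (simp add: G_def)
  qed (use assms(1-17) G_cont G_small G_large K_cont K_nonneg K_lin K_lower in auto)
  have sol: "bvp_solution L \<alpha> \<beta> \<gamma> \<delta> a g b k \<mu> u \<and> positive_on_open L u"
    if "\<mu> > 0" and shot: "shot \<mu> s u v" and s: "0 < s" and zero: "end_value u v = 0" for \<mu> s u v
  proof -
    have \<mu>: "\<mu> \<ge> 0" using that by simp
    note pos = zero_end_value_pos[OF shot \<mu> s zero]
    \<comment> \<open>With \<open>0 \<le> u x \<le> R\<close> the functions \<open>G\<close> and
      \<open>K\<close> agree with \<open>g\<close> and \<open>k\<close> along \<open>u\<close>, so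
      the original equation holds.\<close>
    have le: "u x \<le> R" if "x \<in> {0..L}" for x
      using M1 M2 R order_trans that
      by (intro zero_end_value_bound[OF shot \<mu> s zero]) blast+
    have "rhs \<mu> x (u x) = \<mu> * b x * k (u x) - a x * g (u x)" if "x \<in> {0..L}" for x
      using pos(2)[OF that] le[OF that] by (simp add: rhs_def G_def K_def max_absorb2 min_absorb1)
    then have "bvp_solution L \<alpha> \<beta> \<gamma> \<delta> a g b k \<mu> u"
      using shot_deriv[OF shot] pos(2) L a b g k zero shot_init[OF shot]
      by (intro bvp_solutionI[where v = v]) (auto simp: end_value_def)
    then show ?thesis using pos(1) by (simp add: positive_on_open_def)
  qed
  obtain \<mu>0 where \<mu>0: "\<mu>0 > 0" "\<forall>\<mu>>\<mu>0. \<exists>sA uA vA sB uB vB sC uC vC.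
    shot \<mu> sA uA vA \<and> 0 < sA \<and> end_value uA vA = 0 \<and>
    shot \<mu> sB uB vB \<and> 0 < sB \<and> end_value uB vB = 0 \<and>
    shot \<mu> sC uC vC \<and> 0 < sC \<and> end_value uC vC = 0 \<and>
    (\<exists>x\<in>{0..L}. uA x \<noteq> uB x) \<and> (\<exists>x\<in>{0..L}. uA x \<noteq> uC x) \<and> (\<exists>x\<in>{0..L}. uB x \<noteq> uC x)"
    using three_shots by blast
  show ?thesis
  proof (intro exI[of _ \<mu>0] conjI allI impI \<mu>0(1))
    fix \<mu> assume "\<mu> > \<mu>0"
    then have "\<mu> > 0" using \<mu>0(1) by simp
    from \<mu>0(2)[rule_format, OF \<open>\<mu> > \<mu>0\<close>] obtain sA uA vA sB uB vB sC uC vC where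
      "shot \<mu> sA uA vA" "0 < sA" "end_value uA vA = 0"
      "shot \<mu> sB uB vB" "0 < sB" "end_value uB vB = 0"
      "shot \<mu> sC uC vC" "0 < sC" "end_value uC vC = 0"
      "\<exists>x\<in>{0..L}. uA x \<noteq> uB x" "\<exists>x\<in>{0..L}. uA x \<noteq> uC x" "\<exists>x\<in>{0..L}. uB x \<noteq> uC x"
      by (elim exE conjE) (rule that)
    with sol[OF \<open>\<mu> > 0\<close>] show "\<exists>u1 u2 u3.
           bvp_solution L \<alpha> \<beta> \<gamma> \<delta> a g b k \<mu> u1 \<and> positive_on_open L u1 \<and>
           bvp_solution L \<alpha> \<beta> \<gamma> \<delta> a g b k \<mu> u2 \<and> positive_on_open L u2 \<and>
           bvp_solution L \<alpha> \<beta> \<gamma> \<delta> a g b k \<mu> u3 \<and> positive_on_open L u3 \<and>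
           (\<exists>x\<in>{0..L}. u1 x \<noteq> u2 x) \<and> (\<exists>x\<in>{0..L}. u1 x \<noteq> u3 x) \<and>
           (\<exists>x\<in>{0..L}. u2 x \<noteq> u3 x)"
      by meson
  qed
qed

end
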